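(* Let $F$ be a Banach lattice with order continuous norm. The following conditions are equivalent. (i) $F$ is a KB-space. (ii) $\mathrm{L}_+(F)=\mathrm{L}_{\mathrm{Levi}+}(F)$. (iii) $\mathrm{L}_{\mathrm{qLevi}+}(F)=\mathrm{L}_{\mathrm{Levi}+}(F)$. (iv) $\mathrm{L}_{\mathrm{c\text{-}qLevi}+}(F)=\mathrm{L}_{\mathrm{Levi}+}(F)$. (v) $\mathrm{K}_+(F)\subseteq \mathrm{L}_{\mathrm{Levi}}(F)$.
   Context: All vector spaces are real and all operators are linear and bounded. For a Banach lattice $E$, $B_E$ is the closed unit ball, $E_+$ the positive cone, and $(B_E)_+=B_E\cap E_+$. A Banach lattice is a KB-space if every norm bounded increasing sequence (equivalently, net) in its positive cone is norm convergent. For a net $(y_\beta)$ in a Banach lattice $F$, $y_\beta\downarrow 0$ means $y_{\beta'}\le y_\beta$ for all $\beta'\ge\beta$ and $\inf_F y_\beta=0$. A net $(x_\alpha)$ in $F$ order converges to $x\in F$ if there is a net $(y_\beta)$ in $F$ (possibly over a different index set) with $y_\beta\downarrow 0$ such that for each $\beta$ there is $\alpha_\beta$ with $|x_\alpha-x|\le y_\beta$ for all $\alpha\ge\alpha_\beta$. A net $(x_\alpha)$ is o-Cauchy if the double net $(x_\alpha-x_{\alpha'})_{(\alpha,\alpha')}$ order converges to $0$. Let $\mathrm{L}(E,F)$ and $\mathrm{K}(E,F)$ be the spaces of bounded and of compact operators between Banach lattices $E$ and $F$. An operator $T\in \mathrm{L}(E,F)$ is: - Levi if for every increasing net $(x_\alpha)$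 in $(B_E)_+$ there exists $x\in E$ such that $(Tx_\alpha)$ order converges to $Tx$ in $F$; the set of such operators is $\mathrm{L}_{\mathrm{Levi}}(E,F)$; - quasi-Levi if $T$ takes increasing nets in $(B_E)_+$ to o-Cauchy nets in $F$; the set of such operators is $\mathrm{L}_{\mathrm{qLevi}}(E,F)$; - complete-quasi-Levi if $(Tx_\alpha)$ is order convergent in $F$ for every increasing net $(x_\alpha)$ in $(B_E)_+$; the set of such operators is $\mathrm{L}_{\mathrm{c\text{-}qLevi}}(E,F)$. A subscript $+$ denotes the set of positive operators belonging to the corresponding class. A single argument $(F)$ abbreviates $(F,F)$. *)

theory Defs
  imports "HOL-Analysis.Analysis" "HOL-Library.Lattice_Algebras"
begin

section \<open>Banach lattices\<close>

text \<open>Real Banach lattices; the modulus is the lattice one, \<open>\<bar>x\<bar> = sup x (- x)\<close>,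
  inherited from the class \<open>lattice_ab_group_add_abs\<close>.\<close>

class banach_lattice = banach + ordered_real_vector + lattice_ab_group_add_abs +
  assumes norm_mono_abs: "\<bar>x\<bar> \<le> \<bar>y\<bar> \<Longrightarrow> norm x \<le> norm y"

instance real :: banach_lattice
  by standard (auto simp: sup_real_def abs_if)

definition pos_unit_ball :: "'a::banach_lattice set" where
  "pos_unit_ball = {x \<in> cball 0 1. 0 \<le> x}"

definition KB_space :: "'a::banach_lattice itself \<Rightarrow> bool" where
  "KB_space _ \<longleftrightarrow>
     (\<forall>x :: nat \<Rightarrow> 'a. (\<forall>n. 0 \<le> x n) \<and> incseq x \<and> Bseq x \<longrightarrow> convergent x)"


section \<open>Nets\<close>

text \<open>
  A net is a function restricted to a carrier \<open>A\<close> that is directed upwards by a preorder \<open>r\<close>,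
  where \<open>(a, b) \<in> r\<close> means \<open>b \<ge> a\<close>.

  HOL cannot quantify over index types inside a formula. Where a definition below
  quantifies over index sets, these range over the subsets of the space itself, each with an
  arbitrary directed preorder. The lemmas named \<open>*_any_index\<close> show that nothing is
  lost: the monotone nets concerned may be indexed by any directed subset of any type.
\<close>

definition directed_on :: "'i set \<Rightarrow> 'i rel \<Rightarrow> bool" where
  "directed_on A r \<longleftrightarrow> A \<noteq> {} \<and> preorder_on A r \<and>
     (\<forall>a\<in>A. \<forall>b\<in>A. \<exists>c\<in>A. (a, c) \<in> r \<and> (b, c) \<in> r)"

definition prod_rel :: "'i rel \<Rightarrow> 'j rel \<Rightarrow> ('i \<times> 'j) rel" where
  "prod_rel r s = {((a, b), (a', b')). (a, a') \<in> r \<and> (b, b') \<in> s}"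

definition increasing_net :: "'i set \<Rightarrow> 'i rel \<Rightarrow> ('i \<Rightarrow> 'a::order) \<Rightarrow> bool" where
  "increasing_net A r x \<longleftrightarrow> directed_on A r \<and> (\<forall>(a, b) \<in> r. x a \<le> x b)"

definition decreases_to_zero :: "'i set \<Rightarrow> 'i rel \<Rightarrow> ('i \<Rightarrow> 'a::banach_lattice) \<Rightarrow> bool" where
  "decreases_to_zero B s y \<longleftrightarrow> directed_on B s \<and> (\<forall>(b, c) \<in> s. y c \<le> y b) \<and>
     (\<forall>b\<in>B. 0 \<le> y b) \<and> (\<forall>z. (\<forall>b\<in>B. z \<le> y b) \<longrightarrow> z \<le> 0)"

definition order_converges ::
    "'i set \<Rightarrow> 'i rel \<Rightarrow> ('i \<Rightarrow> 'a::banach_lattice) \<Rightarrow> 'a \<Rightarrow> bool" where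
  "order_converges A r x l \<longleftrightarrow>
     (\<exists>(B :: 'a set) s y. decreases_to_zero B s y \<and>
        (\<forall>b\<in>B. \<exists>a0\<in>A. \<forall>a\<in>A. (a0, a) \<in> r \<longrightarrow> \<bar>x a - l\<bar> \<le> y b))"

definition o_Cauchy :: "'i set \<Rightarrow> 'i rel \<Rightarrow> ('i \<Rightarrow> 'a::banach_lattice) \<Rightarrow> bool" where
  "o_Cauchy A r x \<longleftrightarrow>
     order_converges (A \<times> A) (prod_rel r r) (\<lambda>(a, a'). x a - x a') 0"

definition order_continuous_norm :: "'a::banach_lattice itself \<Rightarrow> bool" where
  "order_continuous_norm _ \<longleftrightarrow>
     (\<forall>(A :: 'a set) r (x :: 'a \<Rightarrow> 'a). decreases_to_zero A r x \<longrightarrow>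
        (\<forall>e>0. \<exists>a0\<in>A. \<forall>a\<in>A. (a0, a) \<in> r \<longrightarrow> norm (x a) < e))"


section \<open>Classes of operators\<close>

definition positive_ops :: "('a::banach_lattice \<Rightarrow>\<^sub>L 'b::banach_lattice) set" where
  "positive_ops = {T. \<forall>x\<ge>0. 0 \<le> blinfun_apply T x}"

definition compact_ops :: "('a::banach_lattice \<Rightarrow>\<^sub>L 'b::banach_lattice) set" where
  "compact_ops = {T. compact (closure (blinfun_apply T ` cball 0 1))}"

definition Levi_ops :: "('a::banach_lattice \<Rightarrow>\<^sub>L 'b::banach_lattice) set" where
  "Levi_ops = {T. \<forall>(A :: 'a set) r (x :: 'a \<Rightarrow> 'a).
     increasing_net A r x \<and> x ` A \<subseteq> pos_unit_ball \<longrightarrow>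
     (\<exists>l. order_converges A r (\<lambda>a. blinfun_apply T (x a)) (blinfun_apply T l))}"

definition quasi_Levi_ops :: "('a::banach_lattice \<Rightarrow>\<^sub>L 'b::banach_lattice) set" where
  "quasi_Levi_ops = {T. \<forall>(A :: 'a set) r (x :: 'a \<Rightarrow> 'a).
     increasing_net A r x \<and> x ` A \<subseteq> pos_unit_ball \<longrightarrow>
     o_Cauchy A r (\<lambda>a. blinfun_apply T (x a))}"

definition complete_quasi_Levi_ops :: "('a::banach_lattice \<Rightarrow>\<^sub>L 'b::banach_lattice) set" where
  "complete_quasi_Levi_ops = {T. \<forall>(A :: 'a set) r (x :: 'a \<Rightarrow> 'a).
     increasing_net A r x \<and> x ` A \<subseteq> pos_unit_ball \<longrightarrow>
     (\<exists>l. order_converges A r (\<lambda>a. blinfun_apply T (x a)) l)}"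


section \<open>Independence of the index types\<close>

lemma directed_on_image:
  assumes A: "directed_on A r"
    and mono: "\<And>a b. (a, b) \<in> r \<Longrightarrow> (x a, x b) \<in> q"
    and q: "refl q" "trans q"
  shows "directed_on (x ` A) (q \<inter> (x ` A) \<times> (x ` A))"
  unfolding directed_on_def
proof (intro conjI ballI)
  show "x ` A \<noteq> {}"
    using A by (simp add: directed_on_def)
  show "preorder_on (x ` A) (q \<inter> (x ` A) \<times> (x ` A))"
    unfolding preorder_on_def
  proof (intro conjI)
    show "refl_on (x ` A) (q \<inter> (x ` A) \<times> (x ` A))"
      using q(1) by (simp add: refl_on_def)
    show "trans (q \<inter> (x ` A) \<times> (x ` A))"
      by (rule transI) (use q(2) in \<open>auto dest: transD\<close>)
  qed simp
next
  fix u v assume "u \<in> x ` A" "v \<in> x ` A"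
  then obtain a b where ab: "a \<in> A" "b \<in> A" "u = x a" "v = x b" by blast
  with A obtain c where "c \<in> A" "(a, c) \<in> r" "(b, c) \<in> r"
    unfolding directed_on_def by metis
  then have "x c \<in> x ` A" "(u, x c) \<in> q \<inter> (x ` A) \<times> (x ` A)" "(v, x c) \<in> q \<inter> (x ` A) \<times> (x ` A)"
    using ab mono by simp_all
  then show "\<exists>w\<in>x ` A. (u, w) \<in> q \<inter> (x ` A) \<times> (x ` A) \<and> (v, w) \<in> q \<inter> (x ` A) \<times> (x ` A)"
    by blast
qed

lemma increasing_net_image:
  fixes x :: "'i \<Rightarrow> 'a::order"
  assumes "increasing_net A r x"
  shows "increasing_net (x ` A) ({(u, v). u \<le> v} \<inter> (x ` A) \<times> (x ` A)) (\<lambda>u. u)"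
proof -
  have "directed_on (x ` A) ({(u, v). u \<le> v} \<inter> (x ` A) \<times> (x ` A))"
    using assms by (intro directed_on_image)
      (auto simp: increasing_net_def refl_on_def trans_def)
  then show ?thesis by (auto simp: increasing_net_def)
qed

lemma decreases_to_zero_image:
  assumes "decreases_to_zero B s y"
  shows "decreases_to_zero (y ` B) ({(u, v). v \<le> u} \<inter> (y ` B) \<times> (y ` B)) (\<lambda>u. u)"
proof -
  have "directed_on (y ` B) ({(u, v). v \<le> u} \<inter> (y ` B) \<times> (y ` B))"
    using assms by (intro directed_on_image)
      (auto simp: decreases_to_zero_def refl_on_def trans_def)
  then show ?thesis using assms by (auto simp: decreases_to_zero_def)
qed

lemma order_converges_any_index:
  fixes x :: "'i \<Rightarrow> 'a::banach_lattice" and y :: "'j \<Rightarrow> 'a"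
  assumes "decreases_to_zero B s y"
    and "\<And>b. b \<in> B \<Longrightarrow> \<exists>a0\<in>A. \<forall>a\<in>A. (a0, a) \<in> r \<longrightarrow> \<bar>x a - l\<bar> \<le> y b"
  shows "order_converges A r x l"
  using decreases_to_zero_image[OF assms(1)] assms(2)
  unfolding order_converges_def by (intro exI conjI) auto

lemma order_continuous_norm_any_index:
  fixes x :: "'i \<Rightarrow> 'a::banach_lattice"
  assumes "order_continuous_norm TYPE('a)" and d: "decreases_to_zero A r x" and "e > 0"
  shows "\<exists>a0\<in>A. \<forall>a\<in>A. (a0, a) \<in> r \<longrightarrow> norm (x a) < e"
proof -
  obtain a0 where "a0 \<in> A"
    and *: "\<And>a. a \<in> A \<Longrightarrow> x a \<le> x a0 \<Longrightarrow> norm (x a) < e"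
    using assms(1)[unfolded order_continuous_norm_def, rule_format,
        OF decreases_to_zero_image[OF d] \<open>e > 0\<close>] by auto
  moreover have "x a \<le> x a0" if "(a0, a) \<in> r" for a
    using d that by (auto simp: decreases_to_zero_def)
  ultimately show ?thesis by blast
qed

lemma order_converges_from_image:
  fixes f :: "'a::order \<Rightarrow> 'b::banach_lattice"
  assumes x: "increasing_net A r x"
    and "order_converges (x ` A) ({(u, v). u \<le> v} \<inter> (x ` A) \<times> (x ` A)) f l"
  shows "order_converges A r (\<lambda>a. f (x a)) l"
proof -
  obtain B :: "'b set" and s y where y: "decreases_to_zero B s y"
    and c: "\<And>b. b \<in> B \<Longrightarrow> \<exists>u0\<in>x ` A. \<forall>u\<in>x ` A.
      (u0, u) \<in> {(u, v). u \<le> v} \<inter> (x ` A) \<times> (x ` A) \<longrightarrow> \<bar>f u - l\<bar> \<le> y b"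
    using assms(2) unfolding order_converges_def by metis
  show ?thesis
  proof (rule order_converges_any_index[OF y])
    fix b assume "b \<in> B"
    then obtain a0 where a0: "a0 \<in> A"
      and le: "\<And>a. a \<in> A \<Longrightarrow> x a0 \<le> x a \<Longrightarrow> \<bar>f (x a) - l\<bar> \<le> y b"
      using c[of b] by auto
    moreover have "x a0 \<le> x a" if "(a0, a) \<in> r" for a
      using x that by (auto simp: increasing_net_def)
    ultimately show "\<exists>a0\<in>A. \<forall>a\<in>A. (a0, a) \<in> r \<longrightarrow> \<bar>f (x a) - l\<bar> \<le> y b"
      by blast
  qed
qed

lemma Levi_any_index:
  fixes x :: "'i \<Rightarrow> 'a::banach_lattice"
  assumes "T \<in> Levi_ops" and x: "increasing_net A r x" and "x ` A \<subseteq> pos_unit_ball"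
  shows "\<exists>l. order_converges A r (\<lambda>a. blinfun_apply T (x a)) (blinfun_apply T l)"
proof -
  let ?r = "{(u, v). u \<le> v} \<inter> (x ` A) \<times> (x ` A)"
  have "increasing_net (x ` A) ?r (\<lambda>u. u) \<and> (\<lambda>u. u) ` x ` A \<subseteq> pos_unit_ball"
    using increasing_net_image[OF x] assms(3) by simp
  then have "\<exists>l. order_converges (x ` A) ?r (blinfun_apply T) (blinfun_apply T l)"
    using assms(1) unfolding Levi_ops_def by blast
  then show ?thesis
    using order_converges_from_image[OF x] by blast
qed

lemma complete_quasi_Levi_any_index:
  fixes x :: "'i \<Rightarrow> 'a::banach_lattice"
  assumes "T \<in> complete_quasi_Levi_ops" and x: "increasing_net A r x"
    and "x ` A \<subseteq> pos_unit_ball"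
  shows "\<exists>l. order_converges A r (\<lambda>a. blinfun_apply T (x a)) l"
proof -
  let ?r = "{(u, v). u \<le> v} \<inter> (x ` A) \<times> (x ` A)"
  have "increasing_net (x ` A) ?r (\<lambda>u. u) \<and> (\<lambda>u. u) ` x ` A \<subseteq> pos_unit_ball"
    using increasing_net_image[OF x] assms(3) by simp
  then have "\<exists>l. order_converges (x ` A) ?r (blinfun_apply T) l"
    using assms(1) unfolding complete_quasi_Levi_ops_def by blast
  then show ?thesis
    using order_converges_from_image[OF x] by blast
qed

lemma quasi_Levi_any_index:
  fixes x :: "'i \<Rightarrow> 'a::banach_lattice" and T :: "'a \<Rightarrow>\<^sub>L 'b::banach_lattice"
  assumes "T \<in> quasi_Levi_ops" and x: "increasing_net A r x" and "x ` A \<subseteq> pos_unit_ball"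
  shows "o_Cauchy A r (\<lambda>a. blinfun_apply T (x a))"
proof -
  let ?r = "{(u, v). u \<le> v} \<inter> (x ` A) \<times> (x ` A)"
  have "increasing_net (x ` A) ?r (\<lambda>u. u) \<and> (\<lambda>u. u) ` x ` A \<subseteq> pos_unit_ball"
    using increasing_net_image[OF x] assms(3) by simp
  then have "o_Cauchy (x ` A) ?r (blinfun_apply T)"
    using assms(1) unfolding quasi_Levi_ops_def by blast
  then obtain B :: "'b set" and s y where y: "decreases_to_zero B s y"
    and c: "\<And>b. b \<in> B \<Longrightarrow> \<exists>p\<in>x ` A \<times> x ` A. \<forall>q\<in>x ` A \<times> x ` A. (p, q) \<in> prod_rel ?r ?r \<longrightarrow>
      \<bar>(case q of (u, v) \<Rightarrow> blinfun_apply T u - blinfun_apply T v) - 0\<bar> \<le> y b"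
    unfolding o_Cauchy_def order_converges_def by metis
  show ?thesis
    unfolding o_Cauchy_def
  proof (rule order_converges_any_index[OF y])
    fix b assume b: "b \<in> B"
    obtain p where p: "p \<in> x ` A \<times> x ` A"
      and P: "\<And>q. q \<in> x ` A \<times> x ` A \<Longrightarrow> (p, q) \<in> prod_rel ?r ?r \<Longrightarrow>
        \<bar>(case q of (u, v) \<Rightarrow> blinfun_apply T u - blinfun_apply T v) - 0\<bar> \<le> y b"
      using c[OF b] by blast
    obtain a0 a1 where a: "a0 \<in> A" "a1 \<in> A" and pe: "p = (x a0, x a1)"
      using p by blast
    have "\<bar>blinfun_apply T (x a) - blinfun_apply T (x a')\<bar> \<le> y b"
      if "a \<in> A" "a' \<in> A" "(a0, a) \<in> r" "(a1, a') \<in> r" for a a'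
    proof -
      have "x a0 \<le> x a" "x a1 \<le> x a'"
        using x that by (auto simp: increasing_net_def)
      then have "(p, (x a, x a')) \<in> prod_rel ?r ?r"
        using a that by (simp add: pe prod_rel_def)
      then show ?thesis using P[of "(x a, x a')"] that by simp
    qed
    then show "\<exists>p\<in>A \<times> A. \<forall>q\<in>A \<times> A. (p, q) \<in> prod_rel r r \<longrightarrow>
        \<bar>(case q of (a, a') \<Rightarrow> blinfun_apply T (x a) - blinfun_apply T (x a')) - 0\<bar> \<le> y b"
      using a by (intro bexI[of _ "(a0, a1)"]) (auto simp: prod_rel_def)
  qed
qed

end

theory Submission
  imports Defs
begin

text \<open>
  If \<open>F\<close> is a KB-space, increasing nets in the positive unit ball converge in norm to an
  upper bound, so every positive operator is Levi. Positive compact operators are always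
  complete-quasi-Levi, hence quasi-Levi, so everything reduces to finding, when \<open>F\<close> has order
  continuous norm and is not a KB-space, a positive compact operator that is not Levi.

  A bounded increasing sequence that is not Cauchy yields disjoint positive \<open>e\<^sub>k\<close> with norms
  bounded away from \<open>0\<close> and norm bounded partial sums. Let \<open>f\<^sub>k\<close> be a positive functional with
  \<open>f\<^sub>k(e\<^sub>k) = norm e\<^sub>k\<close> that lives on the band generated by \<open>e\<^sub>k\<close>, and let \<open>T x\<close> be the sum
  of the \<open>2\<^sup>-\<^sup>k f\<^sub>k(x) e\<^sub>k\<close>. If the images under \<open>T\<close> of the partial sums of the \<open>e\<^sub>k\<close>
  converged to \<open>T l\<close>, then \<open>f\<^sub>k(l) = norm e\<^sub>k\<close> for all \<open>k\<close>; but \<open>f\<^sub>k(l)\<close> tends to \<open>0\<close>,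
  because order bounded disjoint sequences are norm null.
\<close>

section \<open>The Hahn--Banach theorem for sublinear functionals\<close>

definition sublinear :: "('a::real_vector \<Rightarrow> real) \<Rightarrow> bool" where
  "sublinear p \<longleftrightarrow> (\<forall>x y. p (x + y) \<le> p x + p y) \<and> (\<forall>c x. 0 \<le> c \<longrightarrow> p (c *\<^sub>R x) = c * p x)"

lemma sublinear_add: "sublinear p \<Longrightarrow> p (x + y) \<le> p x + p y"
  by (simp add: sublinear_def)

lemma sublinear_scale: "sublinear p \<Longrightarrow> 0 \<le> c \<Longrightarrow> p (c *\<^sub>R x) = c * p x"
  by (simp add: sublinear_def)

lemma sublinear_0: "sublinear p \<Longrightarrow> p 0 = 0"
  using sublinear_scale[of p 0 0] by simp

lemma sublinear_neg: "sublinear p \<Longrightarrow> - p (- x) \<le> p x"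
  using sublinear_add[of p x "- x"] sublinear_0[of p] by simp

text \<open>Applying \<open>le\<close> to the factor \<open>inverse c\<close> and the vector
  \<open>c *\<^sub>R x\<close> gives the opposite inequality, so one inequality for
  \<open>0 < c\<close> already yields homogeneity.\<close>

lemma sublinearI:
  assumes "\<And>x y. p (x + y) \<le> p x + p y"
    and "p 0 = 0"
    and le: "\<And>c x. 0 < c \<Longrightarrow> p (c *\<^sub>R x) \<le> c * p x"
  shows "sublinear p"
proof -
  have "p (c *\<^sub>R x) = c * p x" if "0 \<le> c" for c x
  proof (cases "c = 0")
    case False
    with that have c: "0 < c" by simp
    have "p x \<le> inverse c * p (c *\<^sub>R x)"
      using le[of "inverse c" "c *\<^sub>R x"] c by simp
    then show ?thesis
      using c le[OF c, of x] by (simp add: field_simps)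
  qed (simp add: assms(2))
  with assms(1) show ?thesis by (simp add: sublinear_def)
qed

text \<open>Any linear functional below \<open>p\<close> that agrees with \<open>p\<close> at
  \<open>x\<close> lies below \<open>q\<close>, so passing from \<open>p\<close> to \<open>q\<close>
  forces this agreement. The infimum is finite since \<open>t * p x = p (t *\<^sub>R x)\<close> is
  at most \<open>p (y + t *\<^sub>R x) + p (- y)\<close>.\<close>

lemma sublinear_lower:
  fixes p :: "'a::real_vector \<Rightarrow> real" and x :: 'a
  defines "q \<equiv> \<lambda>y. INF t\<in>{0..}. p (y + t *\<^sub>R x) - t * p x"
  assumes p: "sublinear p"
  shows "sublinear q" and "\<And>y t. 0 \<le> t \<Longrightarrow> q y \<le> p (y + t *\<^sub>R x) - t * p x"
proof -
  have "- p (- y) \<le> p (y + t *\<^sub>R x) - t * p x" if "0 \<le> t" for y t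
    using sublinear_add[OF p, of "y + t *\<^sub>R x" "- y"] sublinear_scale[OF p that, of x] by simp
  then have "bdd_below ((\<lambda>t. p (y + t *\<^sub>R x) - t * p x) ` {0..})" for y
    by (intro bdd_belowI[of _ "- p (- y)"]) auto
  then show le: "q y \<le> p (y + t *\<^sub>R x) - t * p x" if "0 \<le> t" for y t
    unfolding q_def using that by (intro cINF_lower) auto
  have ge: "m \<le> q y" if "\<And>t. 0 \<le> t \<Longrightarrow> m \<le> p (y + t *\<^sub>R x) - t * p x" for m y
    unfolding q_def using that by (intro cINF_greatest) auto
  show "sublinear q"
  proof (rule sublinearI)
    fix y z
    have qle: "q (y + z) \<le> (p (y + t *\<^sub>R x) - t * p x) + (p (z + s *\<^sub>R x) - s * p x)"
      if "0 \<le> t" "0 \<le> s" for t s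
      using le[of "t + s" "y + z"] that sublinear_add[OF p, of "y + t *\<^sub>R x" "z + s *\<^sub>R x"]
      by (simp add: algebra_simps)
    have qz: "q (y + z) - (p (y + t *\<^sub>R x) - t * p x) \<le> q z" if "0 \<le> t" for t
      by (rule ge) (use qle[OF that] in \<open>simp add: diff_le_eq add.commute\<close>)
    have "q (y + z) - q z \<le> q y"
    proof (rule ge)
      fix t :: real assume "0 \<le> t"
      from qz[OF this] show "q (y + z) - q z \<le> p (y + t *\<^sub>R x) - t * p x" by linarith
    qed
    then show "q (y + z) \<le> q y + q z" by simp
  next
    have "(\<lambda>t. p (0 + t *\<^sub>R x) - t * p x) ` {0..} = {0}"
      using sublinear_scale[OF p, of _ x] by force
    then show "q 0 = 0" unfolding q_def by simp
  next
    fix c :: real and y assume c: "0 < c"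
    have "q (c *\<^sub>R y) / c \<le> q y"
    proof (rule ge)
      fix t :: real assume t: "0 \<le> t"
      have "c *\<^sub>R y + (c * t) *\<^sub>R x = c *\<^sub>R (y + t *\<^sub>R x)"
        by (simp add: algebra_simps)
      then have "q (c *\<^sub>R y) \<le> c * (p (y + t *\<^sub>R x) - t * p x)"
        using le[of "c * t" "c *\<^sub>R y"] c t sublinear_scale[OF p, of c "y + t *\<^sub>R x"]
        by (simp add: algebra_simps)
      then show "q (c *\<^sub>R y) / c \<le> p (y + t *\<^sub>R x) - t * p x"
        using c by (simp add: field_simps)
    qed
    then show "q (c *\<^sub>R y) \<le> c * q y"
      using c by (simp add: field_simps)
  qed
qed

text \<open>All members are bounded below at \<open>x\<close> by \<open>- p (- x)\<close>, so the
  infima are finite. Subadditivity uses the chain: the smaller of \<open>q\<close> and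
  \<open>r\<close> is subadditive and bounds the value at \<open>x + y\<close> by
  \<open>q x + r y\<close>.\<close>

lemma sublinear_chain_Inf:
  fixes p :: "'a::real_vector \<Rightarrow> real"
  assumes "C \<noteq> {}" and C: "\<And>q. q \<in> C \<Longrightarrow> sublinear q \<and> q \<le> p"
    and chain: "\<And>q r. q \<in> C \<Longrightarrow> r \<in> C \<Longrightarrow> q \<le> r \<or> r \<le> q"
  shows "sublinear (\<lambda>x. INF q\<in>C. q x)" and "\<And>q x. q \<in> C \<Longrightarrow> (INF q\<in>C. q x) \<le> q x"
proof -
  have "- p (- x) \<le> q x" if "q \<in> C" for q x
    using sublinear_neg[of q x] C[OF that] by (auto dest: le_funD[of q p "- x"])
  then have "bdd_below ((\<lambda>q. q x) ` C)" for x
    by (intro bdd_belowI[of _ "- p (- x)"]) auto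
  then show le: "(INF q\<in>C. q x) \<le> q x" if "q \<in> C" for q x
    using that by (intro cINF_lower) auto
  have ge: "m \<le> (INF q\<in>C. q x)" if "\<And>q. q \<in> C \<Longrightarrow> m \<le> q x" for m x
    using assms(1) that by (intro cINF_greatest) auto
  show "sublinear (\<lambda>x. INF q\<in>C. q x)"
  proof (rule sublinearI)
    fix x y
    have qle: "(INF q\<in>C. q (x + y)) \<le> q x + r y" if qr: "q \<in> C" "r \<in> C" for q r
    proof -
      obtain m where m: "m \<in> C" "m \<le> q" "m \<le> r"
        using chain[OF qr] qr by blast
      then have "m (x + y) \<le> q x + r y"
        using sublinear_add[of m x y] C[OF m(1)] le_funD[OF m(2), of x] le_funD[OF m(3), of y]
        by linarith
      then show ?thesis using le[OF m(1), of "x + y"] by linarith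
    qed
    have qy: "(INF q\<in>C. q (x + y)) - q x \<le> (INF q\<in>C. q y)" if "q \<in> C" for q
      by (rule ge) (use qle[OF that] in \<open>simp add: diff_le_eq add.commute\<close>)
    have "(INF q\<in>C. q (x + y)) - (INF q\<in>C. q y) \<le> (INF q\<in>C. q x)"
    proof (rule ge)
      fix q assume "q \<in> C"
      from qy[OF this] show "(INF q\<in>C. q (x + y)) - (INF q\<in>C. q y) \<le> q x" by linarith
    qed
    then show "(INF q\<in>C. q (x + y)) \<le> (INF q\<in>C. q x) + (INF q\<in>C. q y)" by simp
  next
    have "(\<lambda>q. q 0) ` C = {0}"
      using assms(1) C sublinear_0 by fastforce
    then show "(INF q\<in>C. q 0) = 0" by simp
  next
    fix c :: real and x assume c: "0 < c"
    have "(INF q\<in>C. q (c *\<^sub>R x)) / c \<le> (INF q\<in>C. q x)"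
    proof (rule ge)
      fix q assume q: "q \<in> C"
      then have "q (c *\<^sub>R x) = c * q x" using C c sublinear_scale[of q c x] by simp
      then show "(INF q\<in>C. q (c *\<^sub>R x)) / c \<le> q x"
        using le[OF q, of "c *\<^sub>R x"] c by (simp add: field_simps)
    qed
    then show "(INF q\<in>C. q (c *\<^sub>R x)) \<le> c * (INF q\<in>C. q x)"
      using c by (simp add: field_simps)
  qed
qed

text \<open>The functional is a minimal sublinear one below \<open>p\<close>: lowering it in a direction \<open>x\<close>
  must not change it, which is additivity.\<close>

lemma exists_linear_below_sublinear:
  fixes p :: "'a::real_vector \<Rightarrow> real"
  assumes p: "sublinear p"
  obtains f where "linear f" "\<And>x. f x \<le> p x"
proof -
  define S where "S = {q. sublinear q \<and> q \<le> p}"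
  \<comment> \<open>The order is reversed, so that the maximal element supplied by Zorn's lemma is a
    minimal sublinear functional.\<close>
  have po: "partial_order_on S (relation_of (\<ge>) S)"
    by (rule partial_order_on_relation_ofI) auto
  have "\<exists>m\<in>S. \<forall>q\<in>S. q \<le> m \<longrightarrow> q = m"
  proof (rule predicate_Zorn[OF po])
    fix C assume "C \<in> Chains (relation_of (\<ge>) S)"
    then have sub: "\<And>q. q \<in> C \<Longrightarrow> q \<in> S"
      and ch: "\<And>q r. q \<in> C \<Longrightarrow> r \<in> C \<Longrightarrow> q \<le> r \<or> r \<le> q"
      by (auto simp: Chains_def relation_of_def)
    show "\<exists>u\<in>S. \<forall>q\<in>C. u \<le> q"
    proof (cases "C = {}")
      case True
      then show ?thesis using p by (auto simp: S_def)
    next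
      case False
      let ?u = "\<lambda>x. INF q\<in>C. q x"
      have C: "\<And>q. q \<in> C \<Longrightarrow> sublinear q \<and> q \<le> p" using sub by (simp add: S_def)
      have lower: "\<forall>q\<in>C. ?u \<le> q"
        using sublinear_chain_Inf(2)[OF False C ch] by (auto simp: le_fun_def)
      obtain q where "q \<in> C" using False by blast
      with lower C have "?u \<le> p" by (blast intro: order_trans)
      then have "?u \<in> S" using sublinear_chain_Inf(1)[OF False C ch] by (simp add: S_def)
      with lower show ?thesis by blast
    qed
  qed
  then obtain m where m: "sublinear m" "m \<le> p" and min: "\<And>q. sublinear q \<Longrightarrow> q \<le> m \<Longrightarrow> q = m"
    unfolding S_def by (auto intro: order_trans)
  have add: "m (y + x) = m y + m x" for x y
  proof -
    note low = sublinear_lower[OF m(1), where x = x]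
    let ?q = "\<lambda>y. INF t\<in>{0..}. m (y + t *\<^sub>R x) - t * m x"
    have "?q \<le> m" using low(2)[of 0] by (simp add: le_fun_def)
    then have "?q = m" by (rule min[OF low(1)])
    then have "m y = ?q y" by (rule fun_cong[symmetric])
    then have "m y \<le> m (y + x) - m x" using low(2)[of 1 y] by simp
    then show ?thesis using sublinear_add[OF m(1), of y x] by simp
  qed
  have neg: "m (- x) = - m x" for x
    using add[of x "- x"] sublinear_0[OF m(1)] by simp
  have "linear m"
  proof (rule linearI)
    fix c :: real and x
    show "m (c *\<^sub>R x) = c *\<^sub>R m x"
      using sublinear_scale[OF m(1), of c x] sublinear_scale[OF m(1), of "- c" x] neg[of "c *\<^sub>R x"]
      by (cases "0 \<le> c") auto
  qed (rule add)
  moreover have "m x \<le> p x" for x using m(2) by (simp add: le_fun_def)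
  ultimately show ?thesis by (rule that)
qed

text \<open>First lower \<open>p\<close> in the direction \<open>e\<close>. The lowered functional
  is at most \<open>- p e\<close> at \<open>- e\<close> (take \<open>t = 1\<close>), so every linear
  functional below it attains \<open>p e\<close> at \<open>e\<close>.\<close>

lemma Hahn_Banach_sublinear:
  fixes p :: "'a::real_vector \<Rightarrow> real"
  assumes p: "sublinear p"
  obtains f where "linear f" "\<And>x. f x \<le> p x" "f e = p e"
proof -
  note low = sublinear_lower[OF p, where x = e]
  obtain f where f: "linear f" "\<And>y. f y \<le> (INF t\<in>{0..}. p (y + t *\<^sub>R e) - t * p e)"
    using exists_linear_below_sublinear[OF low(1)] by blast
  have le: "f y \<le> p y" for y using f(2)[of y] low(2)[of 0 y] by simp
  have "f (- e) \<le> - p e"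
    using f(2)[of "- e"] low(2)[of 1 "- e"] sublinear_0[OF p] by simp
  then have "f e = p e" using le[of e] linear_neg[OF f(1), of e] by simp
  then show ?thesis using that f(1) le by blast
qed

section \<open>Order continuous norms and compact operators\<close>

lemma norm_mono:
  fixes x y :: "'a::banach_lattice"
  shows "0 \<le> x \<Longrightarrow> x \<le> y \<Longrightarrow> norm x \<le> norm y"
  by (rule norm_mono_abs) (simp add: abs_of_nonneg order_trans[of 0 x y])

lemma scaleR_inf:
  fixes a b :: "'a::banach_lattice"
  assumes "0 < c"
  shows "c *\<^sub>R inf a b = inf (c *\<^sub>R a) (c *\<^sub>R b)"
proof (rule antisym)
  show "c *\<^sub>R inf a b \<le> inf (c *\<^sub>R a) (c *\<^sub>R b)"
    using assms by (simp add: scaleR_left_mono)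
  have "inverse c *\<^sub>R inf (c *\<^sub>R a) (c *\<^sub>R b) \<le> inverse c *\<^sub>R (c *\<^sub>R a)"
    "inverse c *\<^sub>R inf (c *\<^sub>R a) (c *\<^sub>R b) \<le> inverse c *\<^sub>R (c *\<^sub>R b)"
    using assms by (intro scaleR_left_mono; simp)+
  then have "inverse c *\<^sub>R inf (c *\<^sub>R a) (c *\<^sub>R b) \<le> inf a b"
    using assms by simp
  then have "c *\<^sub>R (inverse c *\<^sub>R inf (c *\<^sub>R a) (c *\<^sub>R b)) \<le> c *\<^sub>R inf a b"
    using assms by (intro scaleR_left_mono) auto
  then show "inf (c *\<^sub>R a) (c *\<^sub>R b) \<le> c *\<^sub>R inf a b"
    using assms by simp
qed

text \<open>The negative part \<open>pprt (- x)\<close> of the limit is dominated by the modulus of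
  \<open>X n - x\<close> for every \<open>n\<close>, so its norm is 0.\<close>

lemma LIMSEQ_nonneg:
  fixes x :: "'a::banach_lattice"
  assumes "X \<longlonglongrightarrow> x" and "\<And>n. 0 \<le> X n"
  shows "0 \<le> x"
proof -
  have "norm (pprt (- x)) \<le> norm (X n - x)" for n
  proof -
    have "- x \<le> X n - x" using assms(2)[of n] by simp
    also have "\<dots> \<le> \<bar>X n - x\<bar>" by (rule abs_ge_self)
    finally have "pprt (- x) \<le> \<bar>X n - x\<bar>" by (simp add: pprt_def)
    then show ?thesis
      by (intro norm_mono_abs) (simp add: abs_of_nonneg)
  qed
  moreover have "(\<lambda>n. norm (X n - x)) \<longlonglongrightarrow> 0"
    using assms(1) by (simp add: LIM_zero tendsto_norm_zero)
  ultimately have "norm (pprt (- x)) \<le> 0"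
    by (intro LIMSEQ_le_const) auto
  then have "pprt (- x) = 0" by simp
  then show ?thesis by (simp only: le_zero_iff_zero_pprt[symmetric] neg_le_0_iff_le)
qed

lemma LIMSEQ_mono:
  fixes x y :: "'a::banach_lattice"
  assumes "X \<longlonglongrightarrow> x" "Y \<longlonglongrightarrow> y" "\<And>n. X n \<le> Y n"
  shows "x \<le> y"
  using LIMSEQ_nonneg[OF tendsto_diff[OF assms(2,1)]] assms(3) by simp

lemma incseq_LIMSEQ_upper:
  fixes x :: "'a::banach_lattice"
  assumes "incseq X" "X \<longlonglongrightarrow> x"
  shows "X n \<le> x"
  by (rule LIMSEQ_mono[OF tendsto_const LIMSEQ_ignore_initial_segment[OF assms(2), of n]])
     (use assms(1) in \<open>simp add: incseq_def\<close>)

lemma banach_lattice_archimedean: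
  fixes z b :: "'a::banach_lattice"
  assumes "\<And>n::nat. real n *\<^sub>R z \<le> b"
  shows "z \<le> 0"
proof (rule LIMSEQ_mono[OF tendsto_const])
  have "(\<lambda>n. inverse (real (Suc n))) \<longlonglongrightarrow> 0" by (rule LIMSEQ_inverse_real_of_nat)
  from tendsto_scaleR[OF this tendsto_const, of b]
  show "(\<lambda>n. inverse (real (Suc n)) *\<^sub>R b) \<longlonglongrightarrow> 0" by simp
  fix n
  show "z \<le> inverse (real (Suc n)) *\<^sub>R b"
    using scaleR_left_mono[OF assms[of "Suc n"], of "inverse (real (Suc n))"] by simp
qed

text \<open>The left side is below both \<open>inf a c + b\<close> and \<open>inf a c + c\<close>,
  hence below their infimum.\<close>

lemma inf_add_le:
  fixes a b c :: "'a::banach_lattice"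
  assumes "0 \<le> a" "0 \<le> b" "0 \<le> c"
  shows "inf (a + b) c \<le> inf a c + inf b c"
proof -
  have "inf (a + b) c \<le> c + b"
    using assms by (intro le_infI2) simp
  then have "inf (a + b) c \<le> inf a c + b" by (simp add: add_inf_distrib_right)
  moreover have "inf (a + b) c \<le> inf a c + c"
    using assms by (intro le_infI2) simp
  ultimately show ?thesis by (simp add: add_inf_distrib_left)
qed

lemma pprt_add_le:
  fixes a b :: "'a::banach_lattice"
  shows "pprt (a + b) \<le> pprt a + pprt b"
proof -
  have "a + b \<le> pprt a + pprt b" by (intro add_mono) (simp_all add: pprt_def)
  then show ?thesis by (simp add: pprt_def[of "a + b"])
qed

lemma pprt_scaleR:
  fixes a :: "'a::banach_lattice"
  assumes "0 < c"
  shows "pprt (c *\<^sub>R a) = c *\<^sub>R pprt a"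
proof -
  have "pprt b = - inf (- b) 0" for b :: 'a by (simp add: pprt_def neg_inf_eq_sup)
  then show ?thesis using scaleR_inf[OF assms, of "- a" 0] by (simp only: scaleR_minus_right scaleR_zero_right)
qed

lemma inf_scaleR_disjoint:
  fixes a b :: "'a::banach_lattice"
  assumes "0 \<le> a" "0 \<le> b" "inf a b = 0" "0 \<le> s" "0 \<le> t"
  shows "inf (s *\<^sub>R a) (t *\<^sub>R b) = 0"
proof (rule antisym)
  \<comment> \<open>A common factor for both vectors; the summand 1 makes it strictly positive, as
    \<open>scaleR_inf\<close> requires.\<close>
  define m where "m = s + t + 1"
  have "inf (s *\<^sub>R a) (t *\<^sub>R b) \<le> inf (m *\<^sub>R a) (m *\<^sub>R b)"
    using assms by (intro inf_mono scaleR_right_mono) (auto simp: m_def)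
  also have "\<dots> = m *\<^sub>R inf a b"
    using assms by (intro scaleR_inf[symmetric]) (simp add: m_def)
  finally show "inf (s *\<^sub>R a) (t *\<^sub>R b) \<le> 0" using assms by simp
qed (use assms in \<open>simp add: scaleR_nonneg_nonneg\<close>)

text \<open>The sum of disjoint positive vectors is their supremum: a partial sum stays disjoint
  from the next term, and \<open>a + b = inf a b + sup a b\<close>.\<close>

lemma sum_disjoint_le:
  fixes y :: "nat \<Rightarrow> 'a::banach_lattice"
  assumes y: "\<And>n. 0 \<le> y n" and disj: "\<And>m n. m \<noteq> n \<Longrightarrow> inf (y m) (y n) = 0"
    and le: "\<And>n. y n \<le> b"
  shows "sum y {..<n} \<le> b"
proof (induction n)
  case 0
  then show ?case using order_trans[OF y le] by simp
next
  case (Suc n)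
  have "inf (sum y {..<m}) (y n) \<le> 0" if "m \<le> n" for m
    using that
  proof (induction m)
    case (Suc m)
    have "inf (sum y {..<m} + y m) (y n) \<le> inf (sum y {..<m}) (y n) + inf (y m) (y n)"
      by (intro inf_add_le sum_nonneg y)
    also have "\<dots> \<le> 0" using Suc disj[of m n] by simp
    finally show ?case by simp
  qed (simp add: y le_infI1)
  from this[of n] have "sum y {..<n} + y n \<le> sup (sum y {..<n}) (y n)"
    by (subst add_eq_inf_sup) simp
  also have "\<dots> \<le> b" using Suc le by simp
  finally show ?case by simp
qed

section \<open>Order continuity of the norm and order bounded sequences\<close>

text \<open>The differences between the upper bounds of the sequence and its terms form a net that
  decreases to \<open>0\<close>; no supremum is needed.\<close>

lemma order_bounded_incseq_Cauchy:
  fixes x :: "nat \<Rightarrow> 'a::banach_lattice"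
  assumes oc: "order_continuous_norm TYPE('a)"
    and x: "incseq x" and bdd: "\<And>n. x n \<le> b"
  shows "Cauchy x"
proof -
  define D where "D = {d. \<forall>n. x n \<le> d}"
  define A where "A = D \<times> (UNIV :: nat set)"
  define r where "r = {((d, n), (d', n')). d \<in> D \<and> d' \<in> D \<and> d' \<le> d \<and> (n::nat) \<le> n'}"
  let ?y = "\<lambda>(d, n). d - x n"
  have b: "b \<in> D" using bdd by (simp add: D_def)
  have mono: "x m \<le> x n" if "m \<le> n" for m n using x that by (simp add: incseq_def)
  have "directed_on A r"
    unfolding directed_on_def
  proof (intro conjI ballI)
    show "A \<noteq> {}" using b by (auto simp: A_def)
    show "preorder_on A r"
      unfolding preorder_on_def
      by (auto simp: A_def r_def refl_on_def trans_def intro: order_trans)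
    fix p q assume "p \<in> A" "q \<in> A"
    then show "\<exists>c\<in>A. (p, c) \<in> r \<and> (q, c) \<in> r"
      by (intro bexI[of _ "(inf (fst p) (fst q), max (snd p) (snd q))"])
        (auto simp: A_def r_def D_def)
  qed
  moreover have "z \<le> 0" if z: "\<And>d n. d \<in> D \<Longrightarrow> z \<le> d - x n" for z
  proof -
    \<comment> \<open>A lower bound \<open>z\<close> of all differences can be subtracted from any
      upper bound of the sequence. Iterating from \<open>b\<close> bounds every multiple of
      \<open>z\<close> by \<open>b - x 0\<close>, and the Archimedean property gives
      \<open>z <= 0\<close>.\<close>
    have step: "d - z \<in> D" if "d \<in> D" for d
      using z[OF that] by (auto simp: D_def algebra_simps)
    have "b - real k *\<^sub>R z \<in> D" for k
    proof (induction k)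
      case (Suc k)
      from step[OF this] show ?case by (simp add: algebra_simps)
    qed (simp add: b)
    then have "real k *\<^sub>R z \<le> b - x 0" for k by (auto simp: D_def algebra_simps)
    then show ?thesis by (rule banach_lattice_archimedean)
  qed
  ultimately have dec: "decreases_to_zero A r ?y"
    unfolding decreases_to_zero_def
    by (auto simp: A_def r_def D_def intro!: diff_mono mono)
  show ?thesis
  proof (rule metric_CauchyI)
    fix e :: real assume "0 < e"
    from order_continuous_norm_any_index[OF oc dec, of "e / 2"] this
    obtain d n where d: "d \<in> D" and lt: "\<And>m. n \<le> m \<Longrightarrow> norm (d - x m) < e / 2"
      by (auto simp: A_def r_def)
    have "dist (x m) (x k) < e" if "n \<le> m" "n \<le> k" for m k
      using lt[OF that(1)] lt[OF that(2)] norm_triangle_ineq4[of "d - x k" "d - x m"]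
      by (simp add: dist_norm)
    then show "\<exists>M. \<forall>m\<ge>M. \<forall>n\<ge>M. dist (x m) (x n) < e" by blast
  qed
qed

text \<open>The partial sums increase and are bounded by \<open>b\<close> because of disjointness,
  so they are Cauchy and the terms of the series tend to 0.\<close>

lemma disjoint_order_bounded_tendsto_0:
  fixes y :: "nat \<Rightarrow> 'a::banach_lattice"
  assumes "order_continuous_norm TYPE('a)"
    and y: "\<And>n. 0 \<le> y n" and "\<And>m n. m \<noteq> n \<Longrightarrow> inf (y m) (y n) = 0"
    and "\<And>n. y n \<le> b"
  shows "y \<longlonglongrightarrow> 0"
proof -
  have "incseq (\<lambda>n. sum y {..<n})" by (rule incseq_SucI) (simp add: y)
  then have "Cauchy (\<lambda>n. sum y {..<n})"
    using order_bounded_incseq_Cauchy[OF assms(1)] sum_disjoint_le[of y, OF assms(2-4)] by blast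
  then have "summable y"
    by (simp add: summable_iff_convergent Cauchy_convergent_iff)
  then show ?thesis by (rule summable_LIMSEQ_zero)
qed

text \<open>Pointwise: either \<open>s + u \<le> c v\<close> and the truncation by \<open>c v\<close> does not affect the increment,
  or \<open>v\<close> is below \<open>(s + u) / c\<close>.\<close>

lemma inf_increment_le:
  fixes s u v :: "'a::banach_lattice"
  assumes "0 \<le> s" "0 \<le> u" "0 < c"
  shows "inf v u \<le> (inf (s + u) (c *\<^sub>R v) - inf s (c *\<^sub>R v)) + inverse c *\<^sub>R (s + u)"
proof -
  define w where "w = inf s (c *\<^sub>R v) + inf v u"
  have su: "0 \<le> s + u" using assms by simp
  have w1: "w \<le> s + u" unfolding w_def by (intro add_mono) auto
  have "w \<le> c *\<^sub>R v + v" unfolding w_def by (intro add_mono) auto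
  then have "c *\<^sub>R w \<le> c *\<^sub>R (c *\<^sub>R v + v)" using assms by (intro scaleR_left_mono) auto
  \<comment> \<open>The bounds \<open>s + u\<close> and \<open>(1 + c) *\<^sub>R v\<close> of
    \<open>w\<close> are averaged with weights \<open>1 / (1 + c)\<close> and
    \<open>c / (1 + c)\<close>, which leaves exactly \<open>c *\<^sub>R v\<close> plus a small
    multiple of \<open>s + u\<close>.\<close>
  with w1 have "w + c *\<^sub>R w \<le> (s + u) + c *\<^sub>R (c *\<^sub>R v + v)" by (rule add_mono)
  then have "inverse (1 + c) *\<^sub>R ((1 + c) *\<^sub>R w) \<le> inverse (1 + c) *\<^sub>R ((s + u) + (1 + c) *\<^sub>R (c *\<^sub>R v))"
    using assms by (intro scaleR_left_mono) (auto simp: algebra_simps)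
  moreover have "inverse (1 + c) * ((1 + c) * c) = c" "inverse (1 + c) * (1 + c) = 1"
    using assms by simp_all
  ultimately have "w \<le> inverse (1 + c) *\<^sub>R (s + u) + c *\<^sub>R v"
    by (simp add: scaleR_add_right[of _ "s + u"] del: scaleR_add_right)
  also have "\<dots> \<le> inverse c *\<^sub>R (s + u) + c *\<^sub>R v"
    using assms su by (intro add_right_mono scaleR_right_mono) auto
  finally have w2: "w \<le> inverse c *\<^sub>R (s + u) + c *\<^sub>R v" .
  have "0 \<le> inverse c *\<^sub>R (s + u)" using assms su by (simp add: scaleR_nonneg_nonneg)
  from add_increasing[OF this w1] have "w \<le> inverse c *\<^sub>R (s + u) + (s + u)" .
  with w2 have "w \<le> inverse c *\<^sub>R (s + u) + inf (s + u) (c *\<^sub>R v)"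
    by (simp add: add_inf_distrib_left)
  then show ?thesis unfolding w_def by (simp add: algebra_simps del: diff_inf_eq_sup)
qed

text \<open>The truncations of \<open>s n\<close> by \<open>c *\<^sub>R v\<close> increase and are
  order bounded, hence Cauchy, so their increments vanish; \<open>inf_increment_le\<close> compares
  these with the increments of \<open>s\<close> itself.\<close>

lemma increments_inf_tendsto_0:
  fixes s :: "nat \<Rightarrow> 'a::banach_lattice"
  assumes oc: "order_continuous_norm TYPE('a)"
    and s: "incseq s" and pos: "\<And>n. 0 \<le> s n" and bdd: "\<And>n. norm (s n) \<le> 1" and v: "0 \<le> v"
  shows "(\<lambda>n. inf v (s (Suc n) - s n)) \<longlonglongrightarrow> 0"
proof (rule LIMSEQ_I)
  fix e :: real assume e: "0 < e"
  \<comment> \<open>With this \<open>c\<close> the remainder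
    \<open>inverse c *\<^sub>R s (Suc n)\<close> has norm at most \<open>e / 2\<close>.\<close>
  define c where "c = 2 / e"
  have c: "0 < c" using e by (simp add: c_def)
  have "incseq (\<lambda>n. inf (s n) (c *\<^sub>R v))"
    using s by (auto simp: incseq_def intro: le_infI1)
  then have "Cauchy (\<lambda>n. inf (s n) (c *\<^sub>R v))"
    by (rule order_bounded_incseq_Cauchy[OF oc, where b = "c *\<^sub>R v"]) simp
  then obtain N where N: "\<And>m n. N \<le> m \<Longrightarrow> N \<le> n \<Longrightarrow>
      norm (inf (s m) (c *\<^sub>R v) - inf (s n) (c *\<^sub>R v)) < e / 2"
    using e by (meson CauchyD half_gt_zero)
  have "norm (inf v (s (Suc n) - s n)) < e" if "N \<le> n" for n
  proof -
    have u: "0 \<le> s (Suc n) - s n" using s by (simp add: incseq_SucD)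
    have "norm (inf v (s (Suc n) - s n)) \<le>
        norm ((inf (s (Suc n)) (c *\<^sub>R v) - inf (s n) (c *\<^sub>R v)) + inverse c *\<^sub>R s (Suc n))"
      using inf_increment_le[OF pos u c, of v n] u v
      by (intro norm_mono) auto
    also have "\<dots> \<le> norm (inf (s (Suc n)) (c *\<^sub>R v) - inf (s n) (c *\<^sub>R v)) + inverse c * norm (s (Suc n))"
      using c by (intro norm_triangle_le add_left_mono) simp
    also have "\<dots> < e / 2 + inverse c * 1"
      using N[of "Suc n" n] that bdd[of "Suc n"] c
      by (intro add_less_le_mono mult_left_mono) auto
    finally show ?thesis by (simp add: c_def)
  qed
  then show "\<exists>N. \<forall>n\<ge>N. norm (inf v (s (Suc n) - s n) - 0) < e" by auto
qed

section \<open>Component functionals and the diagonal operator\<close>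

text \<open>The sublinear functional \<open>p\<close> is the norm of the component of the positive part in the band
  generated by \<open>e\<close>, written without band projections, which need not exist in this generality.\<close>

lemma component_functional:
  fixes e :: "'a::banach_lattice"
  assumes e: "0 \<le> e"
  obtains f where "linear f" "\<And>x. 0 \<le> x \<Longrightarrow> 0 \<le> f x" "f e = norm e" "\<And>x. \<bar>f x\<bar> \<le> norm x"
    "\<And>x m. 0 \<le> x \<Longrightarrow> (\<And>t. 0 \<le> t \<Longrightarrow> norm (inf x (t *\<^sub>R e)) \<le> m) \<Longrightarrow> f x \<le> m"
proof -
  define p where "p x = (SUP t\<in>{0..}. norm (inf (pprt x) (t *\<^sub>R e)))" for x
  have nn: "0 \<le> inf (pprt x) (t *\<^sub>R e)" if "0 \<le> t" for x t
    using that e by (simp add: scaleR_nonneg_nonneg)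
  have bd: "norm (inf (pprt x) (t *\<^sub>R e)) \<le> norm (pprt x)" if "0 \<le> t" for x t
    using nn[OF that] by (intro norm_mono) auto
  have le: "norm (inf (pprt x) (t *\<^sub>R e)) \<le> p x" if "0 \<le> t" for x t
    unfolding p_def using that bd
    by (intro cSUP_upper bdd_aboveI[of _ "norm (pprt x)"]) auto
  have ge: "p x \<le> m" if "\<And>t. 0 \<le> t \<Longrightarrow> norm (inf (pprt x) (t *\<^sub>R e)) \<le> m" for m x
    unfolding p_def using that by (intro cSUP_least) auto
  have p_norm: "p x \<le> norm (pprt x)" for x by (rule ge) (rule bd)
  have "sublinear p"
  proof (rule sublinearI)
    fix x y
    show "p (x + y) \<le> p x + p y"
    proof (rule ge)
      fix t :: real assume t: "0 \<le> t"
      have "inf (pprt (x + y)) (t *\<^sub>R e) \<le> inf (pprt x + pprt y) (t *\<^sub>R e)"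
        by (intro inf_mono pprt_add_le order_refl)
      also have "\<dots> \<le> inf (pprt x) (t *\<^sub>R e) + inf (pprt y) (t *\<^sub>R e)"
        using t e by (intro inf_add_le) (auto simp: scaleR_nonneg_nonneg)
      finally have "norm (inf (pprt (x + y)) (t *\<^sub>R e)) \<le> norm \<dots>"
        using nn[OF t] by (intro norm_mono)
      then show "norm (inf (pprt (x + y)) (t *\<^sub>R e)) \<le> p x + p y"
        using norm_triangle_ineq[of "inf (pprt x) (t *\<^sub>R e)" "inf (pprt y) (t *\<^sub>R e)"]
          le[OF t, of x] le[OF t, of y] by linarith
    qed
  next
    show "p 0 = 0"
      using p_norm[of 0] le[of 0 0] by simp
  next
    fix c :: real and x assume c: "0 < c"
    show "p (c *\<^sub>R x) \<le> c * p x"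
    proof (rule ge)
      fix t :: real assume t: "0 \<le> t"
      have "inf (pprt (c *\<^sub>R x)) (t *\<^sub>R e) = c *\<^sub>R inf (pprt x) ((t / c) *\<^sub>R e)"
        using c by (simp add: pprt_scaleR scaleR_inf)
      then show "norm (inf (pprt (c *\<^sub>R x)) (t *\<^sub>R e)) \<le> c * p x"
        using c t le[of "t / c" x] by simp
    qed
  qed
  then obtain f where f: "linear f" "\<And>x. f x \<le> p x" "f e = p e"
    using Hahn_Banach_sublinear[of p e] by blast
  have le_m: "f x \<le> m" if "0 \<le> x" "\<And>t. 0 \<le> t \<Longrightarrow> norm (inf x (t *\<^sub>R e)) \<le> m" for x m
    using f(2)[of x] ge[of x m] that by simp
  \<comment> \<open>Since \<open>p\<close> only sees positive parts,
    \<open>f (- x) <= p (- x) <= 0\<close> for positive \<open>x\<close>; this makes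
    \<open>f\<close> positive.\<close>
  have "p (- x) \<le> 0" if "0 \<le> x" for x
    using p_norm[of "- x"] that by simp
  then have pos: "0 \<le> f x" if "0 \<le> x" for x
    using f(2)[of "- x"] linear_neg[OF f(1), of x] that by (metis neg_le_0_iff_le order_trans)
  have fe: "f e = norm e"
    using f(3) p_norm[of e] le[of 1 e] e by simp
  have up: "f x \<le> norm x" for x
  proof -
    have "norm (pprt x) \<le> norm x"
      by (rule norm_mono_abs) (simp add: pprt_def abs_of_nonneg abs_ge_self)
    then show ?thesis using f(2)[of x] p_norm[of x] by linarith
  qed
  have "\<bar>f x\<bar> \<le> norm x" for x
    using up[of x] up[of "- x"] linear_neg[OF f(1), of x] by simp
  from that[OF f(1) pos fe this le_m] show ?thesis .
qed

text \<open>The unit ball is mapped into a continuous image of the compact cube \<open>[-1, 1]\<^sup>\<nat>\<close>.\<close>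

lemma compact_diagonal_operator:
  fixes e :: "nat \<Rightarrow> 'a::banach_lattice" and f :: "nat \<Rightarrow> 'a \<Rightarrow> real"
  assumes e: "\<And>k. norm (e k) \<le> 1" and f: "\<And>k. linear (f k)" "\<And>k x. \<bar>f k x\<bar> \<le> norm x"
  obtains T :: "'a \<Rightarrow>\<^sub>L 'a" where "T \<in> compact_ops"
    "\<And>x. (\<lambda>k. ((1/2) ^ k * f k x) *\<^sub>R e k) sums blinfun_apply T x"
proof -
  define g where "g k x = ((1/2) ^ k * f k x) *\<^sub>R e k" for k x
  have g_norm: "norm (g k x) \<le> norm x * (1/2) ^ k" for k x
  proof -
    have "norm (g k x) = \<bar>f k x\<bar> * norm (e k) * (1/2) ^ k" by (simp add: g_def abs_mult)
    also have "\<dots> \<le> norm x * 1 * (1/2) ^ k"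
      using e f by (intro mult_right_mono mult_mono) auto
    finally show ?thesis by simp
  qed
  have sm: "summable (\<lambda>k. norm x * (1/2) ^ k)" for x :: 'a
    by (intro summable_mult summable_geometric) simp
  then have g_sum: "summable (\<lambda>k. g k x)" for x
    by (rule summable_comparison_test'[where N = 0]) (rule g_norm)
  have "bounded_linear (\<lambda>x. \<Sum>k. g k x)"
  proof (rule bounded_linear_intro[where K = 2])
    fix x y
    have "g k (x + y) = g k x + g k y" for k
      by (simp add: g_def linear_add[OF f(1)] algebra_simps)
    then show "(\<Sum>k. g k (x + y)) = (\<Sum>k. g k x) + (\<Sum>k. g k y)"
      by (simp add: suminf_add[OF g_sum g_sum])
  next
    fix c x
    have "g k (c *\<^sub>R x) = c *\<^sub>R g k x" for k
      by (simp add: g_def linear_scale[OF f(1)])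
    then show "(\<Sum>k. g k (c *\<^sub>R x)) = c *\<^sub>R (\<Sum>k. g k x)"
      by (simp add: suminf_scaleR_right[OF g_sum])
  next
    fix x
    have "norm (\<Sum>k. g k x) \<le> (\<Sum>k. norm x * (1/2) ^ k)"
      using g_norm sm by (intro norm_suminf_le) auto
    also have "\<dots> = norm x * 2"
      by (simp add: suminf_mult suminf_geometric)
    finally show "norm (\<Sum>k. g k x) \<le> norm x * 2" .
  qed
  then have T: "blinfun_apply (Blinfun (\<lambda>x. \<Sum>k. g k x)) x = (\<Sum>k. g k x)" for x
    by (simp add: bounded_linear_Blinfun_apply)
  define Q where "Q = PiE (UNIV :: nat set) (\<lambda>_. {-1..1::real})"
  define \<Phi> where "\<Phi> a = (\<Sum>k. ((1/2) ^ k * a k) *\<^sub>R e k)" for a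
  have "compactin (product_topology (\<lambda>_. euclidean) UNIV) Q"
    unfolding Q_def by (subst compactin_PiE) simp
  then have "compact Q" by (simp add: euclidean_product_topology)
  \<comment> \<open>Each partial sum depends on finitely many coordinates, hence is continuous for
    the product topology; the weights make the convergence uniform on \<open>Q\<close>.\<close>
  moreover have "continuous_on Q \<Phi>"
  proof (rule uniform_limit_theorem)
    show "uniform_limit Q (\<lambda>n a. \<Sum>k<n. ((1/2) ^ k * a k) *\<^sub>R e k) \<Phi> sequentially"
      unfolding \<Phi>_def
    proof (rule Weierstrass_m_test)
      fix k and a :: "nat \<Rightarrow> real" assume "a \<in> Q"
      then have "\<bar>a k\<bar> * norm (e k) \<le> 1 * 1"
        using e by (intro mult_mono) (auto simp: Q_def abs_le_iff PiE_iff minus_le_iff)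
      then show "norm (((1/2) ^ k * a k) *\<^sub>R e k) \<le> (1/2) ^ k"
        by (simp add: abs_mult field_simps)
    qed (simp add: summable_geometric)
    show "\<forall>\<^sub>F n in sequentially. continuous_on Q (\<lambda>a. \<Sum>k<n. ((1/2) ^ k * a k) *\<^sub>R e k)"
      by (intro always_eventually allI continuous_intros
          continuous_on_subset[OF continuous_on_product_coordinates subset_UNIV])
  qed simp
  ultimately have "compact (\<Phi> ` Q)" by (rule compact_continuous_image[rotated])
  moreover have "(\<Sum>k. g k x) \<in> \<Phi> ` Q" if "norm x \<le> 1" for x
  proof
    show "(\<Sum>k. g k x) = \<Phi> (\<lambda>k. f k x)" by (simp add: \<Phi>_def g_def)
    show "(\<lambda>k. f k x) \<in> Q"
      using order_trans[OF f(2) that] by (auto simp: Q_def abs_le_iff minus_le_iff)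
  qed
  ultimately have "closure (blinfun_apply (Blinfun (\<lambda>x. \<Sum>k. g k x)) ` cball 0 1) \<subseteq> \<Phi> ` Q"
    by (intro closure_minimal compact_imp_closed) (auto simp: T)
  with \<open>compact (\<Phi> ` Q)\<close> have "compact (closure (blinfun_apply (Blinfun (\<lambda>x. \<Sum>k. g k x)) ` cball 0 1))"
    by (metis closed_closure compact_Int_closed inf.absorb_iff2)
  then have "Blinfun (\<lambda>x. \<Sum>k. g k x) \<in> compact_ops" by (simp add: compact_ops_def)
  moreover have "(\<lambda>k. g k x) sums blinfun_apply (Blinfun (\<lambda>x. \<Sum>k. g k x)) x" for x
    using summable_sums[OF g_sum] by (simp add: T)
  ultimately show ?thesis
    unfolding g_def by (rule that)
qed

section \<open>Disjoint sequences in spaces that are not KB\<close>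

lemma not_KB_increments:
  assumes "\<not> KB_space TYPE('a::banach_lattice)"
  obtains X :: "nat \<Rightarrow> 'a::banach_lattice" and d where "incseq X" "\<And>n. 0 \<le> X n" "\<And>n. norm (X n) \<le> 1"
    "0 < d" "\<And>n. d \<le> norm (X (Suc n) - X n)"
proof -
  obtain x :: "nat \<Rightarrow> 'a" where x: "\<And>n. 0 \<le> x n" "incseq x" "Bseq x" "\<not> convergent x"
    using assms unfolding KB_space_def by blast
  obtain K where K: "0 < K" "\<And>n. norm (x n) \<le> K"
    using x(3) by (auto elim: BseqE)
  have "\<not> Cauchy x" using x(4) by (simp add: Cauchy_convergent_iff)
  then obtain d where d: "0 < d" and far: "\<And>M. \<exists>m\<ge>M. \<exists>n\<ge>M. d \<le> dist (x m) (x n)"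
    unfolding Cauchy_def by (meson not_le)
  \<comment> \<open>If all later terms were within \<open>d / 2\<close> of \<open>x M\<close>, any
    two of them would be within \<open>d\<close> of each other.\<close>
  have next_: "\<exists>n>M. d / 2 \<le> norm (x n - x M)" for M
  proof (rule ccontr)
    assume "\<not> ?thesis"
    then have "dist (x n) (x M) < d / 2" if "M \<le> n" for n
      using that d by (cases "n = M") (auto simp: dist_norm not_le)
    moreover obtain m n where "M \<le> m" "M \<le> n" "d \<le> dist (x m) (x n)" using far by blast
    ultimately show False using dist_triangle_half_l[of "x m" "x M" d "x n"] by fastforce
  qed
  obtain g where g: "\<And>n. g n < g (Suc n) \<and> d / 2 \<le> norm (x (g (Suc n)) - x (g n))"
    using dependent_nat_choice[of "\<lambda>_ _. True" "\<lambda>_ a b. a < b \<and> d / 2 \<le> norm (x b - x a)"] next_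
    by auto
  show ?thesis
  proof (rule that)
    show "incseq (\<lambda>n. inverse K *\<^sub>R x (g n))"
    proof (rule incseq_SucI)
      fix n show "inverse K *\<^sub>R x (g n) \<le> inverse K *\<^sub>R x (g (Suc n))"
        using K(1) g[of n] x(2) by (intro scaleR_left_mono) (auto simp: incseq_def)
    qed
    show "0 \<le> inverse K *\<^sub>R x (g n)" for n
      using K(1) x(1) by (simp add: scaleR_nonneg_nonneg)
    show "norm (inverse K *\<^sub>R x (g n)) \<le> 1" for n
      using K by (simp add: field_simps)
    show "0 < inverse K * (d / 2)" using K d by simp
    show "inverse K * (d / 2) \<le> norm (inverse K *\<^sub>R x (g (Suc n)) - inverse K *\<^sub>R x (g n))" for n
    proof -
      have "norm (inverse K *\<^sub>R x (g (Suc n)) - inverse K *\<^sub>R x (g n)) =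
          inverse K * norm (x (g (Suc n)) - x (g n))"
        using K(1) by (simp flip: scaleR_diff_right)
      then show ?thesis using K(1) g[of n] by simp
    qed
  qed
qed

text \<open>The vector \<open>b - inverse t *\<^sub>R a\<close> is a positive multiple of
  \<open>- (a - t *\<^sub>R b)\<close>, so the two positive parts are multiples of the positive and
  negative parts of one vector, which are disjoint.\<close>

lemma inf_pprt_disjoint:
  fixes a b :: "'a::banach_lattice"
  assumes t: "0 < t"
  shows "inf (pprt (a - t *\<^sub>R b)) (pprt (b - inverse t *\<^sub>R a)) = 0"
proof -
  have dis: "inf (pprt x) (pprt (- x)) = 0" for x :: 'a
  proof -
    have "pprt (- x) = pprt x - x" using prts[of x] by (simp add: pprt_neg algebra_simps)
    then have "inf (pprt x) (pprt (- x)) = pprt x + inf 0 (- x)"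
      by (simp add: add_inf_distrib_left)
    also have "inf 0 (- x) = - pprt x"
      by (simp add: pprt_def neg_sup_eq_inf inf_commute)
    finally show ?thesis by simp
  qed
  have "b - inverse t *\<^sub>R a = inverse t *\<^sub>R (- (a - t *\<^sub>R b))"
    using t by (simp add: algebra_simps)
  then have "pprt (b - inverse t *\<^sub>R a) = inverse t *\<^sub>R pprt (- (a - t *\<^sub>R b))"
    using t by (simp only: pprt_scaleR positive_imp_inverse_positive)
  then show ?thesis
    using inf_scaleR_disjoint[OF _ _ dis[of "a - t *\<^sub>R b"], of 1 "inverse t"] t by simp
qed

text \<open>The increments are almost disjoint along a subsequence \<open>u\<close>, since their infima with a fixed
  vector tend to \<open>0\<close>. Subtracting a large multiple of the earlier terms and a small multiple \<open>c\<close>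
  of a weighted sum \<open>W\<close> of all of them makes the positive parts exactly disjoint.\<close>

lemma not_KB_disjoint:
  assumes oc: "order_continuous_norm TYPE('a::banach_lattice)"
    and "\<not> KB_space TYPE('a)"
  obtains e :: "nat \<Rightarrow> 'a::banach_lattice" and d where "\<And>n. 0 \<le> e n" "\<And>m n. m \<noteq> n \<Longrightarrow> inf (e m) (e n) = 0"
    "\<And>n. norm (sum e {..<n}) \<le> 1" "0 < d" "\<And>n. d \<le> norm (e n)"
proof -
  obtain X :: "nat \<Rightarrow> 'a" and d where X: "incseq X" "\<And>n. 0 \<le> X n" "\<And>n. norm (X n) \<le> 1"
    and d: "0 < d" "\<And>n. d \<le> norm (X (Suc n) - X n)"
    using not_KB_increments[OF assms(2)] by blast
  have Xm: "X m \<le> X n" if "m \<le> n" for m n using X(1) that by (simp add: incseq_def)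
  \<comment> \<open>Below, \<open>W\<close> has norm at most 2, so subtracting
    \<open>c *\<^sub>R W\<close> costs at most \<open>d / 4\<close> in norm.\<close>
  define c where "c = d / 8"
  have c: "0 < c" using d by (simp add: c_def)
  \<comment> \<open>The reciprocal of the multiple of \<open>u n\<close> that lies below
    \<open>c *\<^sub>R W\<close>; reciprocal factors are what \<open>inf_pprt_disjoint\<close>
    needs.\<close>
  define C where "C n = inverse (c * (1/2) ^ n)" for n
  have C: "0 < C n" for n using c by (simp add: C_def)
  \<comment> \<open>The vector \<open>X (Suc a)\<close> will dominate the sum of all increments
    chosen so far, so one new increment is made almost disjoint from all of them at once.\<close>
  have "\<exists>b>a. norm (inf (C (Suc n) *\<^sub>R X (Suc a)) (X (Suc b) - X b)) \<le> d / 4" for a n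
  proof -
    have "(\<lambda>b. inf (C (Suc n) *\<^sub>R X (Suc a)) (X (Suc b) - X b)) \<longlonglongrightarrow> 0"
      using C[of "Suc n"] X by (intro increments_inf_tendsto_0 oc) (auto simp: scaleR_nonneg_nonneg)
    from LIMSEQ_D[OF this, of "d / 4"] d obtain N where
      "\<And>b. N \<le> b \<Longrightarrow> norm (inf (C (Suc n) *\<^sub>R X (Suc a)) (X (Suc b) - X b)) < d / 4" by auto
    from this[of "max N (Suc a)"] show ?thesis by (intro exI[of _ "max N (Suc a)"]) auto
  qed
  then obtain g where g: "\<And>n. g n < g (Suc n)"
    "\<And>n. norm (inf (C (Suc n) *\<^sub>R X (Suc (g n))) (X (Suc (g (Suc n))) - X (g (Suc n)))) \<le> d / 4"
    using dependent_nat_choice[of "\<lambda>_ _. True"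
      "\<lambda>n a b. a < b \<and> norm (inf (C (Suc n) *\<^sub>R X (Suc a)) (X (Suc b) - X b)) \<le> d / 4"]
    by auto
  define u where "u n = X (Suc (g n)) - X (g n)" for n
  have u0: "0 \<le> u n" for n using Xm by (simp add: u_def)
  have u1: "norm (u n) \<le> 1" for n
    using u0[of n] X(2)[of "g n"] X(3)[of "Suc (g n)"] norm_mono[of "u n" "X (Suc (g n))"]
    by (simp add: u_def)
  \<comment> \<open>The chosen increments belong to non-overlapping steps of \<open>X\<close>, so
    their sum telescopes up to discarded positive increments.\<close>
  have sum_u: "sum u {..<Suc n} \<le> X (Suc (g n))" for n
  proof (induction n)
    case 0
    show ?case using X(2)[of "g 0"] by (simp add: u_def)
  next
    case (Suc n)
    have "sum u {..<Suc n} \<le> X (g (Suc n))"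
      using Suc Xm[of "Suc (g n)" "g (Suc n)"] g(1)[of n] by simp
    then have "sum u {..<Suc n} + u (Suc n) \<le> X (g (Suc n)) + u (Suc n)" by (rule add_right_mono)
    then show ?case by (simp add: u_def)
  qed
  define W where "W = (\<Sum>i. (1/2) ^ i *\<^sub>R u i)"
  have W_norm: "norm ((1/2) ^ i *\<^sub>R u i) \<le> (1/2) ^ i" for i
    using u1[of i] by (simp add: field_simps)
  have geo: "summable (\<lambda>i. (1/2 :: real) ^ i)" by (simp add: summable_geometric)
  have W_sum: "(\<lambda>i. (1/2) ^ i *\<^sub>R u i) sums W"
    unfolding W_def
    by (intro summable_sums summable_comparison_test'[OF geo, where N = 0] W_norm)
  have "norm W \<le> (\<Sum>i. (1/2) ^ i)"
    unfolding W_def by (rule norm_suminf_le[OF W_norm geo])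
  then have W2: "norm W \<le> 2" by (simp add: suminf_geometric)
  have W0: "0 \<le> (1/2) ^ i *\<^sub>R u i" for i using u0 by (simp add: scaleR_nonneg_nonneg)
  have W_ge: "(1/2) ^ i *\<^sub>R u i \<le> W" for i
  proof -
    have "(1/2) ^ i *\<^sub>R u i \<le> sum (\<lambda>i. (1/2) ^ i *\<^sub>R u i) {..<Suc i}"
      using sum_mono2[of "{..<Suc i}" "{i}" "\<lambda>i. (1/2) ^ i *\<^sub>R u i"] W0 by simp
    also have "\<dots> \<le> W"
    proof (rule incseq_LIMSEQ_upper)
      show "(\<lambda>n. sum (\<lambda>i. (1/2) ^ i *\<^sub>R u i) {..<n}) \<longlonglongrightarrow> W"
        using W_sum by (simp add: sums_def)
      show "incseq (\<lambda>n. sum (\<lambda>i. (1/2) ^ i *\<^sub>R u i) {..<n})"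
        by (rule incseq_SucI) (simp add: W0)
    qed
    finally show ?thesis .
  qed
  have W_pos: "0 \<le> W" using W_ge[of 0] u0[of 0] by simp
  define v where "v n = sum u {..<n}" for n
  have v0: "0 \<le> v n" for n unfolding v_def by (intro sum_nonneg u0)
  define a where "a n = C n *\<^sub>R v n + c *\<^sub>R W" for n
  have Cv0: "0 \<le> C n *\<^sub>R v n" for n using C[of n] v0 by (simp add: scaleR_nonneg_nonneg)
  have cW0: "0 \<le> c *\<^sub>R W" using c W_pos by (simp add: scaleR_nonneg_nonneg)
  have a0: "0 \<le> a n" for n using Cv0 cW0 by (simp add: a_def)
  define e where "e n = pprt (u n - a n)" for n
  have e0: "0 \<le> e n" for n by (simp add: e_def)
  have eu: "e n \<le> u n" for n using a0[of n] u0[of n] by (simp add: e_def pprt_def)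
  have disj: "inf (e m) (e n) = 0" if "m < n" for m n
  proof (rule antisym)
    \<comment> \<open>The later vector \<open>u n\<close> is controlled in \<open>a m\<close>
      through \<open>W\<close>, with factor \<open>t\<close>; the earlier \<open>u m\<close> is
      controlled in \<open>a n\<close> through \<open>v n\<close>, with factor
      \<open>C n = inverse t\<close>.\<close>
    define t where "t = c * (1/2) ^ n"
    have t: "0 < t" using c by (simp add: t_def)
    have "t *\<^sub>R u n \<le> c *\<^sub>R W"
      using scaleR_left_mono[OF W_ge[of n], of c] c by (simp add: t_def)
    also have "\<dots> \<le> a m" using Cv0 by (simp add: a_def)
    finally have "e m \<le> pprt (u m - t *\<^sub>R u n)" unfolding e_def by simp
    moreover have "inverse t *\<^sub>R u m \<le> a n"
    proof -
      have "u m \<le> v n" unfolding v_def using sum_mono2[of "{..<n}" "{m}" u] that u0 by simp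
      then have "C n *\<^sub>R u m \<le> C n *\<^sub>R v n" using C[of n] by (intro scaleR_left_mono) auto
      also have "\<dots> \<le> a n" using cW0 by (simp add: a_def)
      finally show ?thesis by (simp add: C_def t_def)
    qed
    then have "e n \<le> pprt (u n - inverse t *\<^sub>R u m)" unfolding e_def by simp
    ultimately have "inf (e m) (e n) \<le> inf (pprt (u m - t *\<^sub>R u n)) (pprt (u n - inverse t *\<^sub>R u m))"
      by (rule inf_mono)
    then show "inf (e m) (e n) \<le> 0" by (simp only: inf_pprt_disjoint[OF t])
  qed (simp add: e0)
  have e_norm: "d / 2 \<le> norm (e n)" for n
  proof -
    \<comment> \<open>This is the part of \<open>u n\<close> lost in passing to \<open>e n\<close>.
      The earlier terms and \<open>c *\<^sub>R W\<close> each contribute at most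
      \<open>d / 4\<close>, so at least \<open>d / 2\<close> of the norm survives.\<close>
    have "u n - e n = inf (a n) (u n)"
      by (simp add: e_def pprt_def diff_sup_eq_inf add_inf_distrib_left)
    also have "\<dots> \<le> inf (C n *\<^sub>R v n) (u n) + inf (c *\<^sub>R W) (u n)"
      unfolding a_def by (intro inf_add_le Cv0 cW0 u0)
    also have "\<dots> \<le> inf (C n *\<^sub>R v n) (u n) + c *\<^sub>R W" by (intro add_left_mono) simp
    finally have "norm (u n - e n) \<le> norm (inf (C n *\<^sub>R v n) (u n) + c *\<^sub>R W)"
      using eu[of n] by (intro norm_mono) auto
    also have "\<dots> \<le> norm (inf (C n *\<^sub>R v n) (u n)) + norm (c *\<^sub>R W)" by (rule norm_triangle_ineq)
    also have "norm (c *\<^sub>R W) \<le> d / 4" using W2 c by (simp add: c_def)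
    also have "norm (inf (C n *\<^sub>R v n) (u n)) \<le> d / 4"
    proof (cases n)
      case 0
      then show ?thesis using u0[of 0] d by (simp add: v_def inf_absorb1)
    next
      case (Suc k)
      have "C n *\<^sub>R v n \<le> C n *\<^sub>R X (Suc (g k))"
        using sum_u[of k] C[of n] Suc by (intro scaleR_left_mono) (auto simp: v_def)
      then have "norm (inf (C n *\<^sub>R v n) (u n)) \<le> norm (inf (C n *\<^sub>R X (Suc (g k))) (u n))"
        using Cv0 u0 by (intro norm_mono inf_mono) auto
      also have "\<dots> \<le> d / 4" using g(2)[of k] Suc by (simp add: u_def)
      finally show ?thesis .
    qed
    finally have "norm (u n - e n) \<le> d / 2" by simp
    moreover have "d \<le> norm (u n)" using d(2) by (simp add: u_def)
    ultimately show ?thesis using norm_triangle_ineq2[of "u n" "e n"] by simp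
  qed
  show ?thesis
  proof (rule that[OF e0 _ _ _ e_norm])
    show "inf (e m) (e n) = 0" if "m \<noteq> n" for m n
      using disj[of m n] disj[of n m] that by (cases "m < n") (auto simp: inf_commute)
    show "norm (sum e {..<n}) \<le> 1" for n
    proof (cases n)
      case (Suc k)
      have "sum e {..<n} \<le> sum u {..<n}" by (intro sum_mono eu)
      also have "\<dots> \<le> X (Suc (g k))" using sum_u Suc by simp
      finally have "norm (sum e {..<n}) \<le> norm (X (Suc (g k)))"
        by (intro norm_mono sum_nonneg e0)
      then show ?thesis using X(3) order_trans by blast
    qed simp
    show "0 < d / 2" using d by simp
  qed
qed

section \<open>A positive compact operator that is not Levi\<close>

lemma order_converges_imp_norm:
  fixes x :: "'i \<Rightarrow> 'a::banach_lattice"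
  assumes "order_continuous_norm TYPE('a)" "order_converges A r x l" "0 < e"
  shows "\<exists>a0\<in>A. \<forall>a\<in>A. (a0, a) \<in> r \<longrightarrow> norm (x a - l) < e"
proof -
  obtain B :: "'a set" and s y where y: "decreases_to_zero B s y"
    and c: "\<And>b. b \<in> B \<Longrightarrow> \<exists>a0\<in>A. \<forall>a\<in>A. (a0, a) \<in> r \<longrightarrow> \<bar>x a - l\<bar> \<le> y b"
    using assms(2) unfolding order_converges_def by metis
  obtain b0 where b0: "b0 \<in> B" "\<And>b. b \<in> B \<Longrightarrow> (b0, b) \<in> s \<Longrightarrow> norm (y b) < e"
    using order_continuous_norm_any_index[OF assms(1) y assms(3)] by blast
  have "(b0, b0) \<in> s"
    using y b0(1) by (auto simp: decreases_to_zero_def directed_on_def preorder_on_def intro: refl_onD)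
  then have small: "norm (y b0) < e" using b0 by blast
  have "norm (x a - l) < e" if "\<bar>x a - l\<bar> \<le> y b0" for a
  proof -
    have "norm (x a - l) \<le> norm (y b0)"
      by (rule norm_mono_abs) (rule order_trans[OF that abs_ge_self])
    with small show ?thesis by simp
  qed
  with c[OF b0(1)] show ?thesis by blast
qed

lemma compact_positive_not_Levi:
  assumes oc: "order_continuous_norm TYPE('a::banach_lattice)"
    and "\<not> KB_space TYPE('a)"
  obtains T :: "'a::banach_lattice \<Rightarrow>\<^sub>L 'a" where "T \<in> compact_ops" "T \<in> positive_ops" "T \<notin> Levi_ops"
proof -
  obtain e :: "nat \<Rightarrow> 'a" and d where e0: "\<And>n. 0 \<le> e n"
    and disj: "\<And>m n. m \<noteq> n \<Longrightarrow> inf (e m) (e n) = 0"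
    and sum1: "\<And>n. norm (sum e {..<n}) \<le> 1" and d: "0 < d" "\<And>n. d \<le> norm (e n)"
    using not_KB_disjoint[OF assms] by blast
  have e1: "norm (e k) \<le> 1" for k
  proof -
    have "norm (e k) \<le> norm (sum e {..<Suc k})"
      using sum_mono2[of "{..<Suc k}" "{k}" e] e0 by (intro norm_mono) auto
    then show ?thesis using sum1 order_trans by blast
  qed
  have "\<exists>f. linear f \<and> (\<forall>x\<ge>0. 0 \<le> f x) \<and> f (e k) = norm (e k) \<and> (\<forall>x. \<bar>f x\<bar> \<le> norm x) \<and>
      (\<forall>x\<ge>0. \<forall>m. (\<forall>t\<ge>0. norm (inf x (t *\<^sub>R e k)) \<le> m) \<longrightarrow> f x \<le> m)" for k
    by (rule component_functional[OF e0[of k]]) blast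
  then obtain f where f: "\<And>k. linear (f k)" "\<And>k x. 0 \<le> x \<Longrightarrow> 0 \<le> f k x"
    "\<And>k. f k (e k) = norm (e k)" "\<And>k x. \<bar>f k x\<bar> \<le> norm x"
    "\<And>k x m. 0 \<le> x \<Longrightarrow> (\<And>t. 0 \<le> t \<Longrightarrow> norm (inf x (t *\<^sub>R e k)) \<le> m) \<Longrightarrow> f k x \<le> m"
    by metis
  \<comment> \<open>Disjointness makes every truncation of \<open>e k\<close> by a multiple of
    \<open>e j\<close> zero, so the component bound for \<open>f j\<close> is 0.\<close>
  have f_disj: "f j (e k) = 0" if "j \<noteq> k" for j k
  proof (rule antisym)
    show "f j (e k) \<le> 0"
    proof (rule f(5)[OF e0])
      fix t :: real assume "0 \<le> t"
      then have "inf (1 *\<^sub>R e k) (t *\<^sub>R e j) = 0"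
        using that by (intro inf_scaleR_disjoint e0 disj) auto
      then show "norm (inf (e k) (t *\<^sub>R e j)) \<le> 0" by simp
    qed
  qed (rule f(2)[OF e0])
  have f_blinfun: "bounded_linear (f j)" for j
    using f(1,4) by (intro bounded_linear_intro[where K = 1]) (auto simp: linear_add linear_scale)
  obtain T :: "'a \<Rightarrow>\<^sub>L 'a" where T: "T \<in> compact_ops"
    and sums: "\<And>x. (\<lambda>k. ((1/2) ^ k * f k x) *\<^sub>R e k) sums blinfun_apply T x"
    using compact_diagonal_operator[of e f, OF e1 f(1) f(4)] by blast
  have pos: "T \<in> positive_ops"
    unfolding positive_ops_def
  proof (intro CollectI allI impI)
    fix x :: 'a assume "0 \<le> x"
    then show "0 \<le> blinfun_apply T x"
      using sums[of x] e0 f(2) unfolding sums_def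
      by (elim LIMSEQ_nonneg) (auto intro!: sum_nonneg scaleR_nonneg_nonneg)
  qed
  \<comment> \<open>Applying \<open>f j\<close> to the series isolates its \<open>j\<close>-th
    coefficient, so \<open>f j l\<close> can be recovered from \<open>T l\<close>.\<close>
  have fT: "f j (blinfun_apply T x) = (1/2) ^ j * f j x * norm (e j)" for j x
  proof -
    have "(\<lambda>k. f j (((1/2) ^ k * f k x) *\<^sub>R e k)) sums f j (blinfun_apply T x)"
      by (rule bounded_linear.sums[OF f_blinfun sums])
    moreover have "(\<lambda>k. f j (((1/2) ^ k * f k x) *\<^sub>R e k)) sums ((1/2) ^ j * f j x * norm (e j))"
    proof -
      have "(\<lambda>k. f j (((1/2) ^ k * f k x) *\<^sub>R e k)) =
          (\<lambda>k. if k = j then (1/2) ^ j * f j x * norm (e j) else 0)"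
        using f_disj f(3) by (auto simp: linear_scale[OF f(1)])
      then show ?thesis using sums_single[of j "\<lambda>_. (1/2) ^ j * f j x * norm (e j)"] by simp
    qed
    ultimately show ?thesis by (rule sums_unique2)
  qed
  have "T \<notin> Levi_ops"
  proof
    assume "T \<in> Levi_ops"
    let ?S = "\<lambda>n. sum e {..<n}" and ?r = "{(m, n). m \<le> (n::nat)}"
    have "increasing_net UNIV ?r ?S"
      unfolding increasing_net_def directed_on_def preorder_on_def
      using e0 by (auto simp: refl_on_def trans_def intro!: sum_mono2 intro: max.cobounded1 max.cobounded2)
    moreover have "?S ` UNIV \<subseteq> pos_unit_ball"
      using sum1 e0 by (auto simp: pos_unit_ball_def intro: sum_nonneg)
    ultimately obtain l where
      "order_converges UNIV ?r (\<lambda>n. blinfun_apply T (?S n)) (blinfun_apply T l)"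
      using Levi_any_index[OF \<open>T \<in> Levi_ops\<close>] by blast
    from order_converges_imp_norm[OF oc this]
    have "(\<lambda>n. blinfun_apply T (?S n)) \<longlonglongrightarrow> blinfun_apply T l"
      by (intro LIMSEQ_I) auto
    then have lim: "(\<lambda>n. f j (blinfun_apply T (?S n))) \<longlonglongrightarrow> f j (blinfun_apply T l)" for j
      by (rule bounded_linear.tendsto[OF f_blinfun])
    have fS: "f j (?S n) = norm (e j)" if "j < n" for j n
    proof -
      have "f j (?S n) = (\<Sum>k<n. f j (e k))" by (rule linear_sum[OF f(1)])
      also have "\<dots> = (\<Sum>k<n. if k = j then norm (e j) else 0)"
        by (intro sum.cong) (auto simp: f(3) f_disj)
      finally show ?thesis using that by simp
    qed
    have fl: "d \<le> f j l" for j
    proof -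
      have "\<forall>\<^sub>F n in sequentially. (1/2) ^ j * norm (e j) * norm (e j) = f j (blinfun_apply T (?S n))"
        by (rule eventually_sequentiallyI[of "Suc j"]) (simp add: fT fS)
      then have "(\<lambda>n. f j (blinfun_apply T (?S n))) \<longlonglongrightarrow> (1/2) ^ j * norm (e j) * norm (e j)"
        by (rule Lim_transform_eventually[OF tendsto_const])
      then have "(1/2) ^ j * norm (e j) * norm (e j) = (1/2) ^ j * f j l * norm (e j)"
        using LIMSEQ_unique[OF lim] by (simp add: fT)
      moreover have "norm (e j) \<noteq> 0" using d(1) d(2)[of j] by linarith
      ultimately show ?thesis using d(2)[of j] by simp
    qed
    \<comment> \<open>The component bound on \<open>f j\<close> is available for positive vectors
      only, and positivity of \<open>f j\<close> keeps the lower bound \<open>d\<close> at the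
      positive part.\<close>
    define x where "x = pprt l"
    have x0: "0 \<le> x" by (simp add: x_def)
    have fx: "d \<le> f j x" for j
    proof -
      have "0 \<le> x - l" by (simp add: x_def pprt_def)
      from f(2)[OF this, of j] show ?thesis
        using fl[of j] by (simp add: linear_diff[OF f(1)])
    qed
    \<comment> \<open>Otherwise the component bound would give \<open>f j x <= d / 2\<close>. The
      truncations obtained are disjoint and lie below \<open>x\<close>, so they must be norm null,
      which is the contradiction.\<close>
    have "\<exists>t\<ge>0. d / 2 < norm (inf x (t *\<^sub>R e j))" for j
    proof (rule ccontr)
      assume "\<not> ?thesis"
      then have "f j x \<le> d / 2" by (intro f(5)[OF x0]) (auto simp: not_less)
      then show False using fx[of j] d(1) by linarith
    qed
    then obtain t where t: "\<And>j. 0 \<le> t j" "\<And>j. d / 2 < norm (inf x (t j *\<^sub>R e j))" by metis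
    have "(\<lambda>j. inf x (t j *\<^sub>R e j)) \<longlonglongrightarrow> 0"
    proof (rule disjoint_order_bounded_tendsto_0[OF oc, where b = x])
      show "0 \<le> inf x (t n *\<^sub>R e n)" for n using x0 t e0 by (simp add: scaleR_nonneg_nonneg)
      show "inf (inf x (t m *\<^sub>R e m)) (inf x (t n *\<^sub>R e n)) = 0" if "m \<noteq> n" for m n
      proof (rule antisym)
        have "inf (inf x (t m *\<^sub>R e m)) (inf x (t n *\<^sub>R e n)) \<le> inf (t m *\<^sub>R e m) (t n *\<^sub>R e n)"
          by (intro inf_mono) auto
        also have "\<dots> = 0" by (intro inf_scaleR_disjoint e0 t disj that)
        finally show "inf (inf x (t m *\<^sub>R e m)) (inf x (t n *\<^sub>R e n)) \<le> 0" .
      qed (use x0 t e0 in \<open>simp add: scaleR_nonneg_nonneg\<close>)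
    qed simp
    from LIMSEQ_D[OF this, of "d / 2"] d(1) obtain N where "norm (inf x (t N *\<^sub>R e N)) < d / 2"
      by auto
    with t(2)[of N] show False by simp
  qed
  with T pos show ?thesis by (rule that)
qed

section \<open>Increasing nets, KB-spaces and compact operators\<close>

text \<open>The Cauchy property along sequences makes the whole net Cauchy, since large increments
  could be chained into a sequence. A sequence of indices with ever smaller tails then yields the
  limit.\<close>

lemma increasing_net_convergent:
  fixes x :: "'i \<Rightarrow> 'a::banach_lattice"
  assumes x: "increasing_net A r x"
    and Cauchy: "\<And>b. (\<And>n::nat. b n \<in> A) \<Longrightarrow> incseq (\<lambda>n. x (b n)) \<Longrightarrow> Cauchy (\<lambda>n. x (b n))"
  obtains b l where "\<And>n::nat. b n \<in> A" "(\<lambda>n. x (b n)) \<longlonglongrightarrow> l" "\<And>a. a \<in> A \<Longrightarrow> x a \<le> l"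
proof -
  have mono: "x a \<le> x b" if "(a, b) \<in> r" for a b
    using x that by (auto simp: increasing_net_def)
  have dir: "\<exists>c\<in>A. (a, c) \<in> r \<and> (b, c) \<in> r" if "a \<in> A" "b \<in> A" for a b
    using x that by (auto simp: increasing_net_def directed_on_def)
  obtain a0 where a0: "a0 \<in> A" using x by (auto simp: increasing_net_def directed_on_def)
  have tail: "\<exists>a\<in>A. \<forall>c\<in>A. (a, c) \<in> r \<longrightarrow> norm (x c - x a) < e" if e: "0 < e" for e
  proof (rule ccontr)
    assume "\<not> ?thesis"
    then have next_: "\<exists>c. c \<in> A \<and> (a, c) \<in> r \<and> e \<le> norm (x c - x a)" if "a \<in> A" for a
      using that by (meson not_le)
    obtain b where b: "\<And>n. b n \<in> A" "\<And>n. (b n, b (Suc n)) \<in> r \<and> e \<le> norm (x (b (Suc n)) - x (b n))"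
      using dependent_nat_choice[of "\<lambda>_ a. a \<in> A" "\<lambda>_ a c. (a, c) \<in> r \<and> e \<le> norm (x c - x a)"]
        a0 next_ by blast
    have "Cauchy (\<lambda>n. x (b n))"
      using b mono by (intro Cauchy incseq_SucI) auto
    from CauchyD[OF this e] obtain N where
      "\<And>m n. N \<le> m \<Longrightarrow> N \<le> n \<Longrightarrow> norm (x (b m) - x (b n)) < e" by blast
    from this[of "Suc N" N] b(2)[of N] show False by simp
  qed
  have near: "\<exists>c\<in>A. (a, c) \<in> r \<and> (\<forall>c'\<in>A. (c, c') \<in> r \<longrightarrow> norm (x c' - x c) < e)"
    if a: "a \<in> A" and e: "0 < e" for a and e :: real
  proof -
    obtain a1 where a1: "a1 \<in> A" "\<And>c. c \<in> A \<Longrightarrow> (a1, c) \<in> r \<Longrightarrow> norm (x c - x a1) < e / 2"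
      using tail[of "e / 2"] e by auto
    obtain c where c: "c \<in> A" "(a, c) \<in> r" "(a1, c) \<in> r" using dir[OF a a1(1)] by blast
    have "norm (x c' - x c) < e" if c': "c' \<in> A" "(c, c') \<in> r" for c'
    proof -
      have "(a1, c') \<in> r"
        using x c(3) c'(2) by (auto simp: increasing_net_def directed_on_def preorder_on_def dest: transD)
      then show ?thesis
        using norm_triangle_ineq4[of "x c' - x a1" "x c - x a1"] a1(2)[OF c'(1)] a1(2)[OF c(1,3)]
        by simp
    qed
    with c show ?thesis by blast
  qed
  have near_n: "\<exists>c. c \<in> A \<and> (a, c) \<in> r \<and>
      (\<forall>c'\<in>A. (c, c') \<in> r \<longrightarrow> norm (x c' - x c) < inverse (real (Suc n)))" if "a \<in> A" for a n
    using near[OF that, of "inverse (real (Suc n))"] by auto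
  have "\<exists>b. \<forall>n. b n \<in> A \<and> (b n, b (Suc n)) \<in> r \<and>
      (\<forall>c\<in>A. (b (Suc n), c) \<in> r \<longrightarrow> norm (x c - x (b (Suc n))) < inverse (real (Suc n)))"
    by (rule dependent_nat_choice) (use a0 near_n in blast)+
  then obtain b where b: "\<And>n. b n \<in> A" "\<And>n. (b n, b (Suc n)) \<in> r"
    "\<And>n c. c \<in> A \<Longrightarrow> (b (Suc n), c) \<in> r \<Longrightarrow> norm (x c - x (b (Suc n))) < inverse (real (Suc n))"
    by metis
  have "Cauchy (\<lambda>n. x (b n))"
    using b mono by (intro Cauchy incseq_SucI) auto
  then obtain l where l: "(\<lambda>n. x (b n)) \<longlonglongrightarrow> l"
    by (auto simp: Cauchy_convergent_iff convergent_def)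
  have "x a \<le> l" if a: "a \<in> A" for a
  proof -
    \<comment> \<open>An index above both \<open>a\<close> and \<open>b (Suc n)\<close> gives a
      value that dominates \<open>x a\<close> and is within \<open>inverse (real (Suc n))\<close> of
      \<open>x (b (Suc n))\<close>.\<close>
    have "\<exists>c\<in>A. (a, c) \<in> r \<and> (b (Suc n), c) \<in> r" for n by (rule dir[OF a b(1)])
    then obtain c where c: "\<And>n. c n \<in> A" "\<And>n. (a, c n) \<in> r" "\<And>n. (b (Suc n), c n) \<in> r" by metis
    have "(\<lambda>n. x (c n) - x (b (Suc n))) \<longlonglongrightarrow> 0"
      by (rule Lim_null_comparison[OF _ LIMSEQ_inverse_real_of_nat])
        (use b(3) c in \<open>auto intro!: always_eventually less_imp_le\<close>)
    from tendsto_add[OF this LIMSEQ_Suc[OF l]] have "(\<lambda>n. x (c n)) \<longlonglongrightarrow> l" by simp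
    then show ?thesis by (rule LIMSEQ_mono[OF tendsto_const]) (use c mono in auto)
  qed
  with b(1) l show ?thesis by (rule that)
qed

lemma positive_opsD: "T \<in> positive_ops \<Longrightarrow> x \<le> y \<Longrightarrow> blinfun_apply T x \<le> blinfun_apply T y"
  unfolding positive_ops_def
  by (metis (mono_tags, lifting) blinfun.diff_right diff_ge_0_iff_ge mem_Collect_eq)

text \<open>The dominating net is \<open>l - y a\<close> itself: it decreases, and its infimum is 0
  because it tends to 0 in norm along \<open>b\<close>.\<close>

lemma increasing_net_order_converges:
  fixes y :: "'i \<Rightarrow> 'a::banach_lattice"
  assumes y: "increasing_net A r y" and b: "\<And>n::nat. b n \<in> A" and lim: "(\<lambda>n. y (b n)) \<longlonglongrightarrow> l"
    and le: "\<And>a. a \<in> A \<Longrightarrow> y a \<le> l"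
  shows "order_converges A r y l"
proof (rule order_converges_any_index)
  have "z \<le> 0" if "\<And>a. a \<in> A \<Longrightarrow> z \<le> l - y a" for z
  proof (rule LIMSEQ_mono[OF tendsto_const])
    show "(\<lambda>n. l - y (b n)) \<longlonglongrightarrow> 0" using tendsto_diff[OF tendsto_const lim, of l] by simp
    show "z \<le> l - y (b n)" for n by (rule that[OF b])
  qed
  then show "decreases_to_zero A r (\<lambda>a. l - y a)"
    using y le by (auto simp: decreases_to_zero_def increasing_net_def)
  have "\<bar>y a - l\<bar> \<le> l - y c" if "a \<in> A" "(c, a) \<in> r" for a c
  proof -
    have "y c \<le> y a" using y that(2) by (auto simp: increasing_net_def)
    then show ?thesis using le[OF that(1)] by (simp add: abs_of_nonpos)
  qed
  then show "\<exists>a0\<in>A. \<forall>a\<in>A. (a0, a) \<in> r \<longrightarrow> \<bar>y a - l\<bar> \<le> l - y c" if "c \<in> A" for c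
    using that by blast
qed

lemma increasing_net_positive_op:
  assumes "T \<in> positive_ops" "increasing_net A r x"
  shows "increasing_net A r (\<lambda>a. blinfun_apply T (x a))"
  using assms by (auto simp: increasing_net_def intro!: positive_opsD)

lemma KB_spaceD:
  fixes x :: "nat \<Rightarrow> 'a::banach_lattice"
  shows "KB_space TYPE('a) \<Longrightarrow> (\<And>n. 0 \<le> x n) \<Longrightarrow> incseq x \<Longrightarrow> Bseq x \<Longrightarrow> convergent x"
  by (simp add: KB_space_def)

text \<open>The net has an upper bound \<open>l\<close> that is the norm limit of a sequence of its
  terms. Positivity and continuity of \<open>T\<close> carry both properties over to the images and
  \<open>T l\<close>.\<close>

lemma KB_positive_subset_Levi:
  assumes KB: "KB_space TYPE('a::banach_lattice)"
  shows "(positive_ops :: ('a \<Rightarrow>\<^sub>L 'b::banach_lattice) set) \<subseteq> Levi_ops"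
proof
  fix T :: "'a \<Rightarrow>\<^sub>L 'b" assume T: "T \<in> positive_ops"
  show "T \<in> Levi_ops"
    unfolding Levi_ops_def
  proof (intro CollectI allI impI, elim conjE)
    fix A :: "'a set" and r and x :: "'a \<Rightarrow> 'a"
    assume x: "increasing_net A r x" and ball: "x ` A \<subseteq> pos_unit_ball"
    have "Cauchy (\<lambda>n. x (b n))" if "\<And>n::nat. b n \<in> A" "incseq (\<lambda>n. x (b n))" for b
    proof -
      have "x (b n) \<in> pos_unit_ball" for n using ball that(1) by blast
      then have xb: "norm (x (b n)) \<le> 1" "0 \<le> x (b n)" for n by (simp_all add: pos_unit_ball_def)
      have "Bseq (\<lambda>n. x (b n))" by (rule BseqI') (rule xb(1))
      with KB xb(2) that(2) have "convergent (\<lambda>n. x (b n))" by (rule KB_spaceD)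
      then show ?thesis by (rule convergent_Cauchy)
    qed
    then obtain b l where b: "\<And>n::nat. b n \<in> A" "(\<lambda>n. x (b n)) \<longlonglongrightarrow> l" "\<And>a. a \<in> A \<Longrightarrow> x a \<le> l"
      using increasing_net_convergent[OF x] by metis
    have "order_converges A r (\<lambda>a. blinfun_apply T (x a)) (blinfun_apply T l)"
      by (rule increasing_net_order_converges[OF increasing_net_positive_op[OF T x] b(1)])
        (use b T in \<open>auto intro: blinfun.tendsto tendsto_intros positive_opsD\<close>)
    then show "\<exists>l. order_converges A r (\<lambda>a. blinfun_apply T (x a)) (blinfun_apply T l)" by blast
  qed
qed

text \<open>The limit of a convergent subsequence bounds the whole sequence, and monotonicity of the
  norm squeezes the remaining terms towards it.\<close>

lemma incseq_compact_Cauchy: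
  fixes y :: "nat \<Rightarrow> 'a::banach_lattice"
  assumes y: "incseq y" and K: "compact K" "\<And>n. y n \<in> K"
  shows "Cauchy y"
proof -
  obtain l g where g: "strict_mono g" and lim: "(y \<circ> g) \<longlonglongrightarrow> l"
    using K unfolding compact_def by metis
  have "incseq (y \<circ> g)"
    using y g by (auto simp: incseq_def strict_mono_less_eq)
  from incseq_LIMSEQ_upper[OF this lim] have up: "y (g n) \<le> l" for n by simp
  have le: "y n \<le> l" for n
    using y seq_suble[OF g, of n] up[of n] unfolding incseq_def by (blast intro: order_trans)
  have "y \<longlonglongrightarrow> l"
  proof (rule LIMSEQ_I)
    fix e :: real assume "0 < e"
    from LIMSEQ_D[OF lim this] obtain N where N: "norm (y (g N) - l) < e" by auto
    have "norm (y n - l) < e" if "g N \<le> n" for n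
    proof -
      have "norm (l - y n) \<le> norm (l - y (g N))"
        using le[of n] y that by (intro norm_mono) (auto simp: incseq_def)
      then show ?thesis using N by (simp add: norm_minus_commute)
    qed
    then show "\<exists>no. \<forall>n\<ge>no. norm (y n - l) < e" by blast
  qed
  then show ?thesis by (rule LIMSEQ_imp_Cauchy)
qed

text \<open>Here the convergence argument is applied to the images, which lie in a compact set. The
  limit found in this way need not be a value of \<open>T\<close>, which is the gap between this
  class and the Levi operators.\<close>

lemma compact_positive_subset_complete_quasi_Levi:
  "compact_ops \<inter> positive_ops \<subseteq>
    (complete_quasi_Levi_ops :: ('a::banach_lattice \<Rightarrow>\<^sub>L 'b::banach_lattice) set)"
proof
  fix T :: "'a \<Rightarrow>\<^sub>L 'b" assume "T \<in> compact_ops \<inter> positive_ops"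
  then have K: "compact (closure (blinfun_apply T ` cball 0 1))" and T: "T \<in> positive_ops"
    by (auto simp: compact_ops_def)
  show "T \<in> complete_quasi_Levi_ops"
    unfolding complete_quasi_Levi_ops_def
  proof (intro CollectI allI impI, elim conjE)
    fix A :: "'a set" and r and x :: "'a \<Rightarrow> 'a"
    assume "increasing_net A r x" and ball: "x ` A \<subseteq> pos_unit_ball"
    then have Tx: "increasing_net A r (\<lambda>a. blinfun_apply T (x a))"
      by (intro increasing_net_positive_op T)
    have in_K: "blinfun_apply T (x a) \<in> closure (blinfun_apply T ` cball 0 1)" if "a \<in> A" for a
      using ball that by (intro closure_subset[THEN subsetD]) (auto simp: pos_unit_ball_def)
    have "Cauchy (\<lambda>n. blinfun_apply T (x (b n)))"
      if "\<And>n::nat. b n \<in> A" "incseq (\<lambda>n. blinfun_apply T (x (b n)))" for b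
      using incseq_compact_Cauchy[OF that(2) K] in_K that(1) by blast
    then obtain b l where "\<And>n::nat. b n \<in> A" "(\<lambda>n. blinfun_apply T (x (b n))) \<longlonglongrightarrow> l"
      "\<And>a. a \<in> A \<Longrightarrow> blinfun_apply T (x a) \<le> l"
      using increasing_net_convergent[OF Tx] by metis
    from increasing_net_order_converges[OF Tx this]
    show "\<exists>l. order_converges A r (\<lambda>a. blinfun_apply T (x a)) l" by blast
  qed
qed

section \<open>Inclusions between the operator classes and the equivalences\<close>

text \<open>By the triangle inequality, twice a net dominating the distance to \<open>l\<close>
  dominates the double net of differences.\<close>

lemma order_converges_imp_o_Cauchy:
  fixes x :: "'i \<Rightarrow> 'a::banach_lattice"
  assumes "order_converges A r x l"
  shows "o_Cauchy A r x"
proof -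
  obtain B :: "'a set" and s y where y: "decreases_to_zero B s y"
    and c: "\<And>b. b \<in> B \<Longrightarrow> \<exists>a0\<in>A. \<forall>a\<in>A. (a0, a) \<in> r \<longrightarrow> \<bar>x a - l\<bar> \<le> y b"
    using assms unfolding order_converges_def by metis
  have "z \<le> 0" if z: "\<And>b. b \<in> B \<Longrightarrow> z \<le> 2 *\<^sub>R y b" for z
  proof -
    have "(1/2) *\<^sub>R z \<le> y b" if "b \<in> B" for b
      using scaleR_left_mono[OF z[OF that], of "1/2"] by simp
    then have "(1/2) *\<^sub>R z \<le> 0" using y by (auto simp: decreases_to_zero_def)
    from scaleR_left_mono[OF this, of 2] show ?thesis by simp
  qed
  then have y2: "decreases_to_zero B s (\<lambda>b. 2 *\<^sub>R y b)"
    using y by (auto simp: decreases_to_zero_def scaleR_left_mono scaleR_nonneg_nonneg)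
  show ?thesis
    unfolding o_Cauchy_def
  proof (rule order_converges_any_index[OF y2])
    fix b assume "b \<in> B"
    then obtain a0 where a0: "a0 \<in> A" "\<And>a. a \<in> A \<Longrightarrow> (a0, a) \<in> r \<Longrightarrow> \<bar>x a - l\<bar> \<le> y b"
      using c by blast
    have "\<bar>x a - x a'\<bar> \<le> 2 *\<^sub>R y b" if "a \<in> A" "a' \<in> A" "(a0, a) \<in> r" "(a0, a') \<in> r" for a a'
    proof -
      have "\<bar>(x a - l) - (x a' - l)\<bar> \<le> \<bar>x a - l\<bar> + \<bar>x a' - l\<bar>" by (rule abs_triangle_ineq4)
      also have "\<dots> \<le> y b + y b" using that by (intro add_mono a0)
      finally show ?thesis by (simp add: scaleR_2)
    qed
    then show "\<exists>p\<in>A \<times> A. \<forall>q\<in>A \<times> A. (p, q) \<in> prod_rel r r \<longrightarrow>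
        \<bar>(case q of (a, a') \<Rightarrow> x a - x a') - 0\<bar> \<le> 2 *\<^sub>R y b"
      using a0(1) by (intro bexI[of _ "(a0, a0)"]) (auto simp: prod_rel_def)
  qed
qed

lemma Levi_subset_complete_quasi_Levi: "Levi_ops \<subseteq> complete_quasi_Levi_ops"
  unfolding Levi_ops_def complete_quasi_Levi_ops_def by blast

lemma complete_quasi_Levi_subset_quasi_Levi: "complete_quasi_Levi_ops \<subseteq> quasi_Levi_ops"
  unfolding complete_quasi_Levi_ops_def quasi_Levi_ops_def
  using order_converges_imp_o_Cauchy by blast

theorem theorem5:
  assumes "order_continuous_norm TYPE('f::banach_lattice)"
  shows "(KB_space TYPE('f) \<longleftrightarrow>
            (positive_ops :: ('f \<Rightarrow>\<^sub>L 'f) set) = Levi_ops \<inter> positive_ops) \<and>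
         (KB_space TYPE('f) \<longleftrightarrow>
            (quasi_Levi_ops \<inter> positive_ops :: ('f \<Rightarrow>\<^sub>L 'f) set) = Levi_ops \<inter> positive_ops) \<and>
         (KB_space TYPE('f) \<longleftrightarrow>
            (complete_quasi_Levi_ops \<inter> positive_ops :: ('f \<Rightarrow>\<^sub>L 'f) set)
              = Levi_ops \<inter> positive_ops) \<and>
         (KB_space TYPE('f) \<longleftrightarrow>
            (compact_ops \<inter> positive_ops :: ('f \<Rightarrow>\<^sub>L 'f) set) \<subseteq> Levi_ops)"
proof -
  \<comment> \<open>Both quasi-Levi classes contain the Levi operators and \<open>?K\<close>. Hence
    a KB-space satisfies all the conditions, and each of the three equalities puts \<open>?K\<close>
    inside the Levi operators, which forces the KB property.\<close>
  let ?K = "compact_ops \<inter> positive_ops :: ('f \<Rightarrow>\<^sub>L 'f) set"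
  have "?K \<subseteq> complete_quasi_Levi_ops" "?K \<subseteq> quasi_Levi_ops"
    "Levi_ops \<subseteq> (complete_quasi_Levi_ops :: ('f \<Rightarrow>\<^sub>L 'f) set)"
    "Levi_ops \<subseteq> (quasi_Levi_ops :: ('f \<Rightarrow>\<^sub>L 'f) set)"
    using compact_positive_subset_complete_quasi_Levi Levi_subset_complete_quasi_Levi
      complete_quasi_Levi_subset_quasi_Levi by blast+
  moreover have "KB_space TYPE('f) \<Longrightarrow> (positive_ops :: ('f \<Rightarrow>\<^sub>L 'f) set) \<subseteq> Levi_ops"
    by (rule KB_positive_subset_Levi)
  moreover have "KB_space TYPE('f)" if "?K \<subseteq> Levi_ops"
    using compact_positive_not_Levi[OF assms] that by blast
  ultimately show ?thesis by blast
qed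

end
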